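(* Let $M$ be a simple rank 3 matroid, let $\Gamma_M$ be its Levi graph with arbitrary positive edge lengths, and let $D_M$ be its Cartwright divisor. If $M$ is not realizable, then $R(D_M)$ does not contain any realizable tropical linear series of dimension 2.
   Context: Let $M$ be a simple rank 3 matroid on a finite set $E$ and $H$ its set of rank 2 flats. The Levi graph $\Gamma_M$ is the bipartite graph with vertex set $E\sqcup H$ and an edge $[e,F]$ whenever $e\in F$, considered as a metric graph with arbitrary positive real edge lengths. The Cartwright divisor is $D_M=\sum_{e\in E}e$. A matroid is realizable if it is the matroid of a finite vector configuration over some field. On a metric graph $\Gamma$: a divisor is a finite formal $\mathbb Z$-combination of points, effective ($\ge0$) if all coefficients are nonnegative. $\mathrm{PL}(\Gamma)$ is the set of continuous piecewise-linear functions with integer slopes; $\mathrm{div}(\varphi)$ has multiplicity at $p$ the sum of the incoming slopes (minus the sum of the outgoing slopes) of $\varphi$ at $p$; $R(D)=\{\varphi\in\mathrm{PL}(\Gamma):D+\mathrm{div}(\varphi)\ge0\}$. A tropical submodule of $R(D)$ is a subset closed under pointwise minimum and addition of real constants; it is finitely generated if it consists of all finite combinations $\min_i\{\varphi_i+a_i\}$ of a finite set. $r_{\mathrm{BN}}(\Sigma)$ is the largest integer $r$ such that for every effective $D'$ of degree $r$ there is $\varphi\in\Sigma$ with $D-D'+\mathrm{div}(\varphi)\ge0$. A finite set $\{\varphi_0,\dots,\varphi_s\}$ is tropically dependent if there are reals $a_i$ such that at every point of $\Gamma$ the minimum $\min_i\{\varphi_i+a_i\}$ is achieved at least twice, and independent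 otherwise; $r_{\mathrm{ind}}(\Sigma)$ is the size of the largest independent subset. A tropical linear series of dimension $r$ is a finitely generated $\Sigma\subseteq R(D)$ with $r_{\mathrm{BN}}(\Sigma)=r$, $r_{\mathrm{ind}}(\Sigma)=r+1$. A tropical linear series is realizable if it is the tropicalization of a linear series on an algebraic curve: there are an algebraically closed, spherically complete field $K$ with surjective nontrivial valuation $\mathrm{val}\colon K\to\mathbb R\cup\{\infty\}$, a smooth projective curve $X$ over $K$ with a semistable model whose skeleton (vertices: components of the special fiber; edges: nodes; the edge of a node $xy=t$ has length $\mathrm{val}(t)$) is $\Gamma\subseteq X^{\mathrm{an}}$, a divisor $D_X$ on $X$ retracting to $D$ under $X^{\mathrm{an}}\to\Gamma$, and a subspace $V\subseteq H^0(X,\mathcal O(D_X))$ of vector-space dimension $r+1$ with $\Sigma=\{\mathrm{trop}(f):f\in V\smallsetminus\{0\}\}$, where $\mathrm{trop}(f)\in\mathrm{PL}(\Gamma)$ is given by evaluating on $f$ the valuations on $K(X)$ corresponding to the points of $\Gamma$. *)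

theory Defs
  imports
    "HOL-Analysis.Analysis"
    "HOL-Computational_Algebra.Computational_Algebra"
    "HOL-Algebra.Algebra"
    "HOL-Algebra.Algebraic_Closure_Type"
begin

section \<open>Matroids\<close>

locale matroid =
  fixes E :: "'a set" and indep :: "'a set \<Rightarrow> bool"
  assumes finite_ground: "finite E"
    and indep_ground: "indep S \<Longrightarrow> S \<subseteq> E"
    and indep_empty: "indep {}"
    and indep_subset: "indep S \<Longrightarrow> T \<subseteq> S \<Longrightarrow> indep T"
    and indep_augment: "indep S \<Longrightarrow> indep T \<Longrightarrow> card S < card T \<Longrightarrow> \<exists>x\<in>T - S. indep (insert x S)"

definition mrank :: "('a set \<Rightarrow> bool) \<Rightarrow> 'a set \<Rightarrow> nat" where
  "mrank indep S = Max (card ` {T. T \<subseteq> S \<and> indep T})"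

definition flats :: "'a set \<Rightarrow> ('a set \<Rightarrow> bool) \<Rightarrow> nat \<Rightarrow> 'a set set" where
  "flats E indep k =
     {F. F \<subseteq> E \<and> mrank indep F = k \<and> (\<forall>x\<in>E - F. mrank indep F < mrank indep (insert x F))}"

definition simple_matroid :: "'a set \<Rightarrow> ('a set \<Rightarrow> bool) \<Rightarrow> bool" where
  "simple_matroid E indep \<longleftrightarrow> matroid E indep \<and> (\<forall>x\<in>E. \<forall>y\<in>E. indep {x, y})"

text \<open>A vector configuration is a family \<open>v\<close> indexed by \<open>E\<close>; the \<open>i\<close>-th coordinate of the vector
  at \<open>e\<close> is \<open>v e i\<close>, for \<open>i < n\<close>.\<close>

definition lin_indep_family ::
  "('b, 'm) ring_scheme \<Rightarrow> nat \<Rightarrow> ('a \<Rightarrow> nat \<Rightarrow> 'b) \<Rightarrow> 'a set \<Rightarrow> bool" where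
  "lin_indep_family F n v S \<longleftrightarrow>
     (\<forall>c\<in>S \<rightarrow> carrier F.
        (\<forall>i<n. (\<Oplus>\<^bsub>F\<^esub>e\<in>S. c e \<otimes>\<^bsub>F\<^esub> v e i) = \<zero>\<^bsub>F\<^esub>) \<longrightarrow> (\<forall>e\<in>S. c e = \<zero>\<^bsub>F\<^esub>))"

definition realizable_over :: "('b, 'm) ring_scheme \<Rightarrow> 'a set \<Rightarrow> ('a set \<Rightarrow> bool) \<Rightarrow> bool" where
  "realizable_over F E indep \<longleftrightarrow> field F \<and>
     (\<exists>n v. (\<forall>e\<in>E. \<forall>i<n. v e i \<in> carrier F) \<and>
            (\<forall>S\<subseteq>E. indep S \<longleftrightarrow> lin_indep_family F n v S))"

text \<open>HOL cannot quantify existentially over all fields of all types. It suffices to let the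
  carrier range over the sets of natural numbers: \<open>realizable_over_any_field\<close> below shows that
  a matroid on a finite set realizable over a field of any type is realizable in this sense.\<close>

definition realizable_matroid :: "'a set \<Rightarrow> ('a set \<Rightarrow> bool) \<Rightarrow> bool" where
  "realizable_matroid E indep \<longleftrightarrow> (\<exists>F :: nat ring. realizable_over F E indep)"

lemma countable_generate_field:
  fixes F :: "('b, 'm) ring_scheme"
  assumes "countable H"
  shows "countable (generate_field F H)"
proof -
  define step where "step = (\<lambda>A. A \<union> a_inv F ` A \<union> m_inv F ` A
    \<union> (\<lambda>(x, y). x \<oplus>\<^bsub>F\<^esub> y) ` (A \<times> A) \<union> (\<lambda>(x, y). x \<otimes>\<^bsub>F\<^esub> y) ` (A \<times> A))"
  define G where "G = (\<lambda>n. (step ^^ n) (insert \<one>\<^bsub>F\<^esub> H))"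
  have G_Suc: "G (Suc n) = step (G n)" for n
    by (simp add: G_def)
  have cG: "countable (G n)" for n
  proof (induction n)
    case 0
    show ?case using assms by (simp add: G_def)
  next
    case (Suc n)
    then show ?case by (simp add: G_Suc step_def)
  qed
  have "incseq G"
    by (rule incseq_SucI) (auto simp: G_Suc step_def)
  then have mono: "G m \<subseteq> G (max m n) \<and> G n \<subseteq> G (max m n)" for m n
    by (simp_all add: incseqD)
  have "generate_field F H \<subseteq> (\<Union>n. G n)"
  proof
    fix x assume "x \<in> generate_field F H"
    then show "x \<in> (\<Union>n. G n)"
    proof induction
      case one
      have "\<one>\<^bsub>F\<^esub> \<in> G 0" by (simp add: G_def)
      then show ?case by blast
    next
      case (incl h)
      then have "h \<in> G 0" by (simp add: G_def)
      then show ?case by blast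
    next
      case (a_inv h)
      then obtain n where "h \<in> G n" by blast
      then have "\<ominus>\<^bsub>F\<^esub> h \<in> G (Suc n)" by (simp add: G_Suc step_def)
      then show ?case by blast
    next
      case (m_inv h)
      then obtain n where "h \<in> G n" by blast
      then have "inv\<^bsub>F\<^esub> h \<in> G (Suc n)" by (simp add: G_Suc step_def)
      then show ?case by blast
    next
      case (eng_add h1 h2)
      from eng_add.IH obtain m n where "h1 \<in> G m" "h2 \<in> G n" by auto
      then have "(h1, h2) \<in> G (max m n) \<times> G (max m n)" using mono[of m n] by auto
      then have "(\<lambda>(x, y). x \<oplus>\<^bsub>F\<^esub> y) (h1, h2)
          \<in> (\<lambda>(x, y). x \<oplus>\<^bsub>F\<^esub> y) ` (G (max m n) \<times> G (max m n))"
        by (rule imageI)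
      then have "h1 \<oplus>\<^bsub>F\<^esub> h2 \<in> G (Suc (max m n))"
        unfolding G_Suc step_def prod.case by (rule UnI1[OF UnI2])
      then show ?case by blast
    next
      case (eng_mult h1 h2)
      from eng_mult.IH obtain m n where "h1 \<in> G m" "h2 \<in> G n" by auto
      then have "(h1, h2) \<in> G (max m n) \<times> G (max m n)" using mono[of m n] by auto
      then have "(\<lambda>(x, y). x \<otimes>\<^bsub>F\<^esub> y) (h1, h2)
          \<in> (\<lambda>(x, y). x \<otimes>\<^bsub>F\<^esub> y) ` (G (max m n) \<times> G (max m n))"
        by (rule imageI)
      then have "h1 \<otimes>\<^bsub>F\<^esub> h2 \<in> G (Suc (max m n))"
        unfolding G_Suc step_def prod.case by (rule UnI2)
      then show ?case by blast
    qed
  qed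
  moreover have "countable (\<Union>n. G n)" using cG by blast
  ultimately show ?thesis by (rule countable_subset)
qed

lemma realizable_over_any_field:
  fixes F :: "('b, 'm) ring_scheme"
  assumes "finite E" and "realizable_over F E indep"
  shows "realizable_matroid E indep"
proof -
  interpret F: field F
    using assms(2) by (simp add: realizable_over_def)
  obtain n v where v: "\<And>e i. e \<in> E \<Longrightarrow> i < n \<Longrightarrow> v e i \<in> carrier F"
    and indep: "\<And>S. S \<subseteq> E \<Longrightarrow> indep S \<longleftrightarrow> lin_indep_family F n v S"
    using assms(2) unfolding realizable_over_def by blast
  define rel where "rel = (\<lambda>S c. c \<in> S \<rightarrow> carrier F \<and>
    (\<forall>i<n. (\<Oplus>\<^bsub>F\<^esub>e\<in>S. c e \<otimes>\<^bsub>F\<^esub> v e i) = \<zero>\<^bsub>F\<^esub>) \<and> (\<exists>e\<in>S. c e \<noteq> \<zero>\<^bsub>F\<^esub>))"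
  define cc where "cc = (\<lambda>S. SOME c. rel S c)"
  have dep: "lin_indep_family F n v S \<longleftrightarrow> (\<nexists>c. rel S c)" for S
    unfolding lin_indep_family_def rel_def by blast
  have cc: "rel S (cc S)" if "\<not> lin_indep_family F n v S" for S
    using that unfolding dep cc_def by (metis someI_ex)
  define H where "H = (\<Union>e\<in>E. (\<lambda>i. v e i) ` {..<n}) \<union>
    (\<Union>S\<in>{S. S \<subseteq> E \<and> \<not> lin_indep_family F n v S}. cc S ` S)"
  have "finite {S. S \<subseteq> E \<and> \<not> lin_indep_family F n v S}"
    using assms(1) by simp
  moreover have "finite S" if "S \<subseteq> E" for S
    using assms(1) that finite_subset by blast
  ultimately have "finite H" using assms(1) unfolding H_def by auto
  have ccF: "cc S e \<in> carrier F" if "\<not> lin_indep_family F n v S" "e \<in> S" for S e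
    using cc[OF that(1)] that(2) unfolding rel_def by (auto dest: Pi_mem)
  have "H \<subseteq> carrier F"
    unfolding H_def by (auto intro: v ccF)
  define K where "K = generate_field F H"
  have "countable K"
    unfolding K_def using \<open>finite H\<close> by (intro countable_generate_field countable_finite)
  have HK: "H \<subseteq> K"
    unfolding K_def by (auto intro: generate_field.incl)
  have KF: "K \<subseteq> carrier F"
    unfolding K_def using \<open>H \<subseteq> carrier F\<close> by (rule F.generate_field_incl)
  have fK: "field (F\<lparr>carrier := K\<rparr>)"
    unfolding K_def using \<open>H \<subseteq> carrier F\<close> by (rule F.generate_field_is_field)
  define f where "f = to_nat_on K"
  have inj: "inj_on f K"
    unfolding f_def using \<open>countable K\<close> by (rule inj_on_to_nat_on)
  define N :: "nat ring" where "N = image_ring f (F\<lparr>carrier := K\<rparr>)"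
  have "field N"
    unfolding N_def using field.inj_imp_image_ring_is_field[OF fK] inj by simp
  then interpret N: field N .
  define g where "g = inv_into K f"
  have gf: "g (f x) = x" if "x \<in> K" for x
    using that inj by (simp add: g_def)
  have carN: "carrier N = f ` K"
    by (simp add: N_def image_ring_carrier)
  have closedK: "x \<otimes>\<^bsub>F\<^esub> y \<in> K" "x \<oplus>\<^bsub>F\<^esub> y \<in> K" "\<one>\<^bsub>F\<^esub> \<in> K" if "x \<in> K" "y \<in> K" for x y
    using that unfolding K_def by (auto intro: generate_field.intros)
  have opsN: "f x \<otimes>\<^bsub>N\<^esub> f y = f (x \<otimes>\<^bsub>F\<^esub> y)" "f x \<oplus>\<^bsub>N\<^esub> f y = f (x \<oplus>\<^bsub>F\<^esub> y)" "\<one>\<^bsub>N\<^esub> = f \<one>\<^bsub>F\<^esub>"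
    if "x \<in> K" "y \<in> K" for x y
    using that inj unfolding N_def image_ring_def image_group_def by (simp_all add: monoid.defs)
  have oneK: "\<one>\<^bsub>F\<^esub> \<in> K"
    unfolding K_def by (rule generate_field.one)
  have "g \<in> ring_hom N F"
  proof (rule ring_hom_memI)
    fix x assume "x \<in> carrier N"
    then show "g x \<in> carrier F" using carN gf KF by auto
  next
    fix x y assume "x \<in> carrier N" "y \<in> carrier N"
    then obtain x' y' where xy: "x = f x'" "y = f y'" "x' \<in> K" "y' \<in> K" using carN by auto
    then show "g (x \<otimes>\<^bsub>N\<^esub> y) = g x \<otimes>\<^bsub>F\<^esub> g y" "g (x \<oplus>\<^bsub>N\<^esub> y) = g x \<oplus>\<^bsub>F\<^esub> g y"
      using opsN[of x' y'] closedK[of x' y'] gf by simp_all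
  next
    show "g \<one>\<^bsub>N\<^esub> = \<one>\<^bsub>F\<^esub>" using opsN(3)[OF oneK oneK] gf[OF oneK] by simp
  qed
  then have hom: "ring_hom_cring N F g"
    by (intro ring_hom_cring.intro ring_hom_cring_axioms.intro N.is_cring F.is_cring)
  interpret g: ring_hom_cring N F g by (rule hom)
  have fg: "f (g x) = x" if "x \<in> carrier N" for x
    using that carN gf by auto
  have g0: "g x = \<zero>\<^bsub>F\<^esub> \<longleftrightarrow> x = \<zero>\<^bsub>N\<^esub>" if "x \<in> carrier N" for x
    using that fg g.hom_zero N.zero_closed by metis
  define w where "w = (\<lambda>e i. f (v e i))"
  have vK: "v e i \<in> K" if "e \<in> E" "i < n" for e i
    using that HK unfolding H_def by blast
  have wN: "w e i \<in> carrier N" if "e \<in> E" "i < n" for e i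
    using vK[OF that] carN by (simp add: w_def)
  have sum: "g (\<Oplus>\<^bsub>N\<^esub>e\<in>S. c e \<otimes>\<^bsub>N\<^esub> w e i) = (\<Oplus>\<^bsub>F\<^esub>e\<in>S. g (c e) \<otimes>\<^bsub>F\<^esub> v e i)"
    if "S \<subseteq> E" "i < n" "c \<in> S \<rightarrow> carrier N" for S i c
  proof -
    have cl: "c e \<otimes>\<^bsub>N\<^esub> w e i \<in> carrier N" if "e \<in> S" for e
      using that \<open>S \<subseteq> E\<close> \<open>i < n\<close> \<open>c \<in> S \<rightarrow> carrier N\<close> wN by (intro N.m_closed) auto
    then have "g (\<Oplus>\<^bsub>N\<^esub>e\<in>S. c e \<otimes>\<^bsub>N\<^esub> w e i) = (\<Oplus>\<^bsub>F\<^esub>e\<in>S. (g \<circ> (\<lambda>e. c e \<otimes>\<^bsub>N\<^esub> w e i)) e)"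
      by (intro g.hom_finsum) auto
    also have "\<dots> = (\<Oplus>\<^bsub>F\<^esub>e\<in>S. g (c e) \<otimes>\<^bsub>F\<^esub> v e i)"
    proof (rule F.finsum_cong')
      show "(\<lambda>e. g (c e) \<otimes>\<^bsub>F\<^esub> v e i) \<in> S \<rightarrow> carrier F"
        using that v by (auto intro!: F.m_closed)
      fix e assume "e \<in> S"
      then show "(g \<circ> (\<lambda>e. c e \<otimes>\<^bsub>N\<^esub> w e i)) e = g (c e) \<otimes>\<^bsub>F\<^esub> v e i"
        using that wN vK gf by (auto simp: w_def Pi_def subset_iff)
    qed simp
    finally show ?thesis .
  qed
  have "lin_indep_family N n w S \<longleftrightarrow> lin_indep_family F n v S" if S: "S \<subseteq> E" for S
  proof
    assume L: "lin_indep_family F n v S"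
    show "lin_indep_family N n w S"
      unfolding lin_indep_family_def
    proof (intro ballI impI)
      fix c e
      assume c: "c \<in> S \<rightarrow> carrier N"
        and z: "\<forall>i<n. (\<Oplus>\<^bsub>N\<^esub>e\<in>S. c e \<otimes>\<^bsub>N\<^esub> w e i) = \<zero>\<^bsub>N\<^esub>" and e: "e \<in> S"
      have *: "\<forall>i<n. (\<Oplus>\<^bsub>F\<^esub>e\<in>S. g (c e) \<otimes>\<^bsub>F\<^esub> v e i) = \<zero>\<^bsub>F\<^esub>"
        using z sum[OF S _ c] g.hom_zero by metis
      have gc: "(\<lambda>e. g (c e)) \<in> S \<rightarrow> carrier F" using c by auto
      have "\<forall>e\<in>S. g (c e) = \<zero>\<^bsub>F\<^esub>"
        by (rule mp[OF bspec[OF L[unfolded lin_indep_family_def] gc] *])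
      then have "g (c e) = \<zero>\<^bsub>F\<^esub>" using e by (rule bspec)
      then show "c e = \<zero>\<^bsub>N\<^esub>" using g0 c e by auto
    qed
  next
    assume L: "lin_indep_family N n w S"
    show "lin_indep_family F n v S"
    proof (rule ccontr)
      assume nL: "\<not> lin_indep_family F n v S"
      then have r: "rel S (cc S)" by (rule cc)
      have cK: "cc S e \<in> K" if "e \<in> S" for e
        using that S nL HK unfolding H_def by blast
      define c where "c = (\<lambda>e. f (cc S e))"
      have c: "c \<in> S \<rightarrow> carrier N" using cK carN by (auto simp: c_def)
      have gc: "g (c e) = cc S e" if "e \<in> S" for e using cK[OF that] gf by (simp add: c_def)
      have "(\<Oplus>\<^bsub>N\<^esub>e\<in>S. c e \<otimes>\<^bsub>N\<^esub> w e i) = \<zero>\<^bsub>N\<^esub>" if i: "i < n" for i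
      proof -
        have "(\<Oplus>\<^bsub>F\<^esub>e\<in>S. g (c e) \<otimes>\<^bsub>F\<^esub> v e i) = (\<Oplus>\<^bsub>F\<^esub>e\<in>S. cc S e \<otimes>\<^bsub>F\<^esub> v e i)"
          using cK KF v S i gc by (intro F.finsum_cong') (auto intro!: F.m_closed)
        also have "\<dots> = \<zero>\<^bsub>F\<^esub>" using r i unfolding rel_def by blast
        finally have "g (\<Oplus>\<^bsub>N\<^esub>e\<in>S. c e \<otimes>\<^bsub>N\<^esub> w e i) = \<zero>\<^bsub>F\<^esub>"
          using sum[OF S i c] by simp
        moreover have "(\<Oplus>\<^bsub>N\<^esub>e\<in>S. c e \<otimes>\<^bsub>N\<^esub> w e i) \<in> carrier N"
          using c wN S i by (intro N.finsum_closed) (auto intro!: N.m_closed)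
        ultimately show ?thesis using g0 by blast
      qed
      then have *: "\<forall>i<n. (\<Oplus>\<^bsub>N\<^esub>e\<in>S. c e \<otimes>\<^bsub>N\<^esub> w e i) = \<zero>\<^bsub>N\<^esub>"
        by (intro allI impI)
      have "\<forall>e\<in>S. c e = \<zero>\<^bsub>N\<^esub>"
        by (rule mp[OF bspec[OF L[unfolded lin_indep_family_def] c] *])
      then have "c e = \<zero>\<^bsub>N\<^esub>" if "e \<in> S" for e
        using that by (rule bspec)
      then have "cc S e = \<zero>\<^bsub>F\<^esub>" if "e \<in> S" for e
        using gc[OF that] that g.hom_zero by metis
      then show False using r unfolding rel_def by blast
    qed
  qed
  then have "realizable_over N E indep"
    using \<open>field N\<close> wN indep unfolding realizable_over_def by blast
  then show ?thesis unfolding realizable_matroid_def by blast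
qed

section \<open>Metric graphs\<close>

text \<open>Loops and multiple edges are allowed. The orientation of an edge only serves to
  parametrize it by arc length.\<close>

record ('v, 'e) mgraph =
  verts :: "'v set"
  edges :: "'e set"
  tl_vert :: "'e \<Rightarrow> 'v"
  hd_vert :: "'e \<Rightarrow> 'v"
  len :: "'e \<Rightarrow> real"

definition wf_mgraph :: "('v, 'e) mgraph \<Rightarrow> bool" where
  "wf_mgraph G \<longleftrightarrow> finite (verts G) \<and> finite (edges G) \<and>
     (\<forall>e\<in>edges G. tl_vert G e \<in> verts G \<and> hd_vert G e \<in> verts G \<and> 0 < len G e)"

datatype ('v, 'e) mpoint = Vertex 'v | Inner 'e real

definition points :: "('v, 'e) mgraph \<Rightarrow> ('v, 'e) mpoint set" where
  "points G = Vertex ` verts G \<union> {Inner e s | e s. e \<in> edges G \<and> 0 < s \<and> s < len G e}"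

text \<open>The point at distance \<open>s\<close> from the tail of the closed edge \<open>e\<close>, for \<open>0 \<le> s \<le> len G e\<close>.\<close>

definition edge_pt :: "('v, 'e) mgraph \<Rightarrow> 'e \<Rightarrow> real \<Rightarrow> ('v, 'e) mpoint" where
  "edge_pt G e s =
     (if s = 0 then Vertex (tl_vert G e) else if s = len G e then Vertex (hd_vert G e) else Inner e s)"

inductive walk :: "('v, 'e) mgraph \<Rightarrow> ('v, 'e) mpoint \<Rightarrow> ('v, 'e) mpoint \<Rightarrow> real \<Rightarrow> bool"
  for G where
  refl: "p \<in> points G \<Longrightarrow> walk G p p 0"
| step: "walk G p (edge_pt G e s) l \<Longrightarrow> e \<in> edges G \<Longrightarrow> s \<in> {0..len G e} \<Longrightarrow> s' \<in> {0..len G e}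
         \<Longrightarrow> walk G p (edge_pt G e s') (l + \<bar>s - s'\<bar>)"

definition path_dist :: "('v, 'e) mgraph \<Rightarrow> ('v, 'e) mpoint \<Rightarrow> ('v, 'e) mpoint \<Rightarrow> real" where
  "path_dist G p q = Inf {l. walk G p q l}"

definition mgraph_isometry ::
  "('v, 'e) mgraph \<Rightarrow> ('w, 'f) mgraph \<Rightarrow> (('v, 'e) mpoint \<Rightarrow> ('w, 'f) mpoint) \<Rightarrow> bool" where
  "mgraph_isometry G G' \<theta> \<longleftrightarrow> bij_betw \<theta> (points G) (points G') \<and>
     (\<forall>p\<in>points G. \<forall>q\<in>points G. path_dist G' (\<theta> p) (\<theta> q) = path_dist G p q)"

subsection \<open>Piecewise linear functions and divisors\<close>

text \<open>Continuous and piecewise linear with integer slopes on \<open>{0..l}\<close>, with breakpoints in the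
  finite set \<open>B\<close>; continuity holds because the pieces are closed intervals.\<close>

definition pl_on_interval :: "real \<Rightarrow> (real \<Rightarrow> real) \<Rightarrow> bool" where
  "pl_on_interval l g \<longleftrightarrow> (\<exists>B. finite B \<and>
     (\<forall>s t. 0 \<le> s \<and> s < t \<and> t \<le> l \<and> B \<inter> {s<..<t} = {} \<longrightarrow>
        (\<exists>m::int. \<forall>u\<in>{s..t}. g u = g s + of_int m * (u - s))))"

text \<open>Functions on \<open>points G\<close> are \<open>undefined\<close> elsewhere, so that they are equal iff they agree
  on the metric graph.\<close>

definition PL :: "('v, 'e) mgraph \<Rightarrow> (('v, 'e) mpoint \<Rightarrow> real) set" where
  "PL G = {\<phi> \<in> extensional (points G). \<forall>e\<in>edges G. pl_on_interval (len G e) (\<lambda>s. \<phi> (edge_pt G e s))}"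

text \<open>Tangent directions at \<open>p\<close>: a position \<open>s\<close> of \<open>p\<close> on a closed edge \<open>e\<close> and a sign.
  A loop gives two directions at its vertex.\<close>

definition directions :: "('v, 'e) mgraph \<Rightarrow> ('v, 'e) mpoint \<Rightarrow> ('e \<times> real \<times> real) set" where
  "directions G p = {(e, s, \<sigma>). e \<in> edges G \<and> s \<in> {0..len G e} \<and> edge_pt G e s = p \<and>
     (\<sigma> = 1 \<and> s < len G e \<or> \<sigma> = - 1 \<and> 0 < s)}"

definition out_slope :: "('v, 'e) mgraph \<Rightarrow> (('v, 'e) mpoint \<Rightarrow> real) \<Rightarrow> 'e \<times> real \<times> real \<Rightarrow> int" where
  "out_slope G \<phi> = (\<lambda>(e, s, \<sigma>). THE m. \<forall>\<^sub>F h in at_right 0.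
     \<phi> (edge_pt G e (s + \<sigma> * h)) = \<phi> (edge_pt G e s) + of_int m * h)"

definition pl_div :: "('v, 'e) mgraph \<Rightarrow> (('v, 'e) mpoint \<Rightarrow> real) \<Rightarrow> ('v, 'e) mpoint \<Rightarrow> int" where
  "pl_div G \<phi> p = - (\<Sum>d\<in>directions G p. out_slope G \<phi> d)"

definition divisors :: "'p set \<Rightarrow> ('p \<Rightarrow> int) set" where
  "divisors P = {D. finite {p. D p \<noteq> 0} \<and> {p. D p \<noteq> 0} \<subseteq> P}"

definition degree_div :: "('p \<Rightarrow> int) \<Rightarrow> int" where
  "degree_div D = (\<Sum>p | D p \<noteq> 0. D p)"

definition RD :: "('v, 'e) mgraph \<Rightarrow> (('v, 'e) mpoint \<Rightarrow> int) \<Rightarrow> (('v, 'e) mpoint \<Rightarrow> real) set" where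
  "RD G D = {\<phi> \<in> PL G. \<forall>p\<in>points G. 0 \<le> D p + pl_div G \<phi> p}"

subsection \<open>Tropical linear series\<close>

definition tropical_submodule ::
  "('v, 'e) mgraph \<Rightarrow> (('v, 'e) mpoint \<Rightarrow> real) set \<Rightarrow> bool" where
  "tropical_submodule G \<Sigma> \<longleftrightarrow>
     (\<forall>\<phi>\<in>\<Sigma>. \<forall>\<psi>\<in>\<Sigma>. (\<lambda>p\<in>points G. min (\<phi> p) (\<psi> p)) \<in> \<Sigma>) \<and>
     (\<forall>\<phi>\<in>\<Sigma>. \<forall>a. (\<lambda>p\<in>points G. \<phi> p + a) \<in> \<Sigma>)"

definition fin_generated ::
  "('v, 'e) mgraph \<Rightarrow> (('v, 'e) mpoint \<Rightarrow> real) set \<Rightarrow> bool" where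
  "fin_generated G \<Sigma> \<longleftrightarrow> (\<exists>S. finite S \<and>
     \<Sigma> = {\<lambda>p\<in>points G. Min ((\<lambda>\<phi>. \<phi> p + a \<phi>) ` T) | T a. T \<subseteq> S \<and> T \<noteq> {}})"

definition bn_condition ::
  "('v, 'e) mgraph \<Rightarrow> (('v, 'e) mpoint \<Rightarrow> int) \<Rightarrow> (('v, 'e) mpoint \<Rightarrow> real) set \<Rightarrow> int \<Rightarrow> bool" where
  "bn_condition G D \<Sigma> r \<longleftrightarrow>
     (\<forall>D'\<in>divisors (points G). (\<forall>p. 0 \<le> D' p) \<and> degree_div D' = r \<longrightarrow>
        (\<exists>\<phi>\<in>\<Sigma>. \<forall>p\<in>points G. 0 \<le> D p - D' p + pl_div G \<phi> p))"

definition has_bn_rank ::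
  "('v, 'e) mgraph \<Rightarrow> (('v, 'e) mpoint \<Rightarrow> int) \<Rightarrow> (('v, 'e) mpoint \<Rightarrow> real) set \<Rightarrow> int \<Rightarrow> bool" where
  "has_bn_rank G D \<Sigma> r \<longleftrightarrow> bn_condition G D \<Sigma> r \<and> (\<forall>r'. bn_condition G D \<Sigma> r' \<longrightarrow> r' \<le> r)"

definition trop_dependent ::
  "('v, 'e) mgraph \<Rightarrow> (('v, 'e) mpoint \<Rightarrow> real) set \<Rightarrow> bool" where
  "trop_dependent G S \<longleftrightarrow> (\<exists>a. \<forall>p\<in>points G. \<exists>\<phi>\<in>S. \<exists>\<psi>\<in>S. \<phi> \<noteq> \<psi> \<and>
     \<phi> p + a \<phi> = \<psi> p + a \<psi> \<and> (\<forall>\<eta>\<in>S. \<phi> p + a \<phi> \<le> \<eta> p + a \<eta>))"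

definition has_ind_rank ::
  "('v, 'e) mgraph \<Rightarrow> (('v, 'e) mpoint \<Rightarrow> real) set \<Rightarrow> nat \<Rightarrow> bool" where
  "has_ind_rank G \<Sigma> n \<longleftrightarrow>
     (\<exists>S\<subseteq>\<Sigma>. finite S \<and> \<not> trop_dependent G S \<and> card S = n) \<and>
     (\<forall>S\<subseteq>\<Sigma>. finite S \<and> \<not> trop_dependent G S \<longrightarrow> card S \<le> n)"

definition tropical_linear_series ::
  "('v, 'e) mgraph \<Rightarrow> (('v, 'e) mpoint \<Rightarrow> int) \<Rightarrow> nat \<Rightarrow> (('v, 'e) mpoint \<Rightarrow> real) set \<Rightarrow> bool" where
  "tropical_linear_series G D r \<Sigma> \<longleftrightarrow>
     \<Sigma> \<subseteq> RD G D \<and> tropical_submodule G \<Sigma> \<and> fin_generated G \<Sigma> \<and>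
     has_bn_rank G D \<Sigma> (int r) \<and> has_ind_rank G \<Sigma> (r + 1)"

subsection \<open>The Levi graph and the Cartwright divisor\<close>

definition levi_graph ::
  "'a set \<Rightarrow> ('a set \<Rightarrow> bool) \<Rightarrow> ('a \<times> 'a set \<Rightarrow> real) \<Rightarrow> ('a + 'a set, 'a \<times> 'a set) mgraph" where
  "levi_graph E indep elen =
     \<lparr>verts = Inl ` E \<union> Inr ` flats E indep 2,
      edges = {(e, F). e \<in> F \<and> F \<in> flats E indep 2},
      tl_vert = (\<lambda>(e, F). Inl e),
      hd_vert = (\<lambda>(e, F). Inr F),
      len = elen\<rparr>"

definition cartwright_divisor :: "'a set \<Rightarrow> ('a + 'a set, 'a \<times> 'a set) mpoint \<Rightarrow> int" where
  "cartwright_divisor E p = (if p \<in> (\<lambda>e. Vertex (Inl e)) ` E then 1 else 0)"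

section \<open>Valued fields\<close>

definition field_valuation :: "('a :: field \<Rightarrow> ereal) \<Rightarrow> bool" where
  "field_valuation v \<longleftrightarrow> (\<forall>x. v x \<noteq> -\<infinity>) \<and> (\<forall>x. v x = \<infinity> \<longleftrightarrow> x = 0) \<and>
     (\<forall>x y. v (x * y) = v x + v y) \<and> (\<forall>x y. min (v x) (v y) \<le> v (x + y))"

definition spherically_complete :: "('a :: field \<Rightarrow> ereal) \<Rightarrow> bool" where
  "spherically_complete v \<longleftrightarrow>
     (\<forall>(a :: nat \<Rightarrow> 'a) (r :: nat \<Rightarrow> real).
        (\<forall>n. {x. ereal (r (Suc n)) \<le> v (x - a (Suc n))} \<subseteq> {x. ereal (r n) \<le> v (x - a n)}) \<longrightarrow>
        (\<Inter>n. {x. ereal (r n) \<le> v (x - a n)}) \<noteq> {})"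

text \<open>Surjectivity onto \<open>UNIV - {-\<infinity>}\<close> makes the valuation nontrivial. Algebraic closedness is
  imposed through the type class.\<close>

definition base_field :: "('k :: alg_closed_field \<Rightarrow> ereal) \<Rightarrow> bool" where
  "base_field val \<longleftrightarrow> field_valuation val \<and> range val = UNIV - {-\<infinity>} \<and> spherically_complete val"

definition val_ring :: "('k :: field \<Rightarrow> ereal) \<Rightarrow> 'k set" where
  "val_ring val = {c. 0 \<le> val c}"

definition val_ideal :: "('k :: field \<Rightarrow> ereal) \<Rightarrow> 'k set" where
  "val_ideal val = {c. 0 < val c}"

section \<open>Smooth projective curves\<close>

text \<open>A smooth projective (irreducible) curve over the algebraically closed field \<open>K\<close> is given by
  its function field \<open>\<iota> : K \<rightarrow> F\<close>, a finitely generated extension of transcendence degree 1. Its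
  closed points are the valuation rings of \<open>F\<close> over \<open>K\<close> other than \<open>F\<close>; these are the local rings
  of the points.\<close>

abbreviation subring_rec :: "'a :: comm_ring_1 set \<Rightarrow> 'a ring" where
  "subring_rec A \<equiv> ring_of_type_algebra\<lparr>carrier := A\<rparr>"

definition function_field :: "('k :: field \<Rightarrow> 'f :: field) \<Rightarrow> bool" where
  "function_field \<iota> \<longleftrightarrow> \<iota> \<in> ring_hom ring_of_type_algebra ring_of_type_algebra \<and>
     (\<exists>x. (\<forall>p. p \<noteq> 0 \<longrightarrow> poly (map_poly \<iota> p) x \<noteq> 0) \<and>
        (\<exists>B. finite B \<and> (\<forall>f. \<exists>c. f = (\<Sum>b\<in>B. c b * b) \<and>
           (\<forall>b\<in>B. \<exists>p q. q \<noteq> 0 \<and> c b = poly (map_poly \<iota> p) x / poly (map_poly \<iota> q) x))))"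

definition valuation_subring :: "'f :: field set \<Rightarrow> bool" where
  "valuation_subring W \<longleftrightarrow> subring W ring_of_type_algebra \<and> (\<forall>f. f \<in> W \<or> inverse f \<in> W)"

text \<open>The nonunits of the subring \<open>R\<close>; its maximal ideal when \<open>R\<close> is local.\<close>

definition nonunits :: "'f :: field set \<Rightarrow> 'f set" where
  "nonunits R = {f \<in> R. f = 0 \<or> inverse f \<notin> R}"

definition closed_points :: "('k :: field \<Rightarrow> 'f :: field) \<Rightarrow> 'f set set" where
  "closed_points \<iota> = {W. valuation_subring W \<and> range \<iota> \<subseteq> W \<and> W \<noteq> UNIV}"

text \<open>The vanishing order at \<open>W\<close>, meaningful for \<open>f \<noteq> 0\<close>; \<open>\<pi>\<close> is a uniformizer.\<close>

definition ord_at :: "'f :: field set \<Rightarrow> 'f \<Rightarrow> int" where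
  "ord_at W f = (THE n. \<exists>\<pi> u. nonunits W = {\<pi> * g | g. g \<in> W} \<and> u \<in> W - nonunits W \<and> f = u * \<pi> powi n)"

definition riemann_roch_space :: "('k :: field \<Rightarrow> 'f :: field) \<Rightarrow> ('f set \<Rightarrow> int) \<Rightarrow> 'f set" where
  "riemann_roch_space \<iota> D = {f. f = 0 \<or> (\<forall>W\<in>closed_points \<iota>. 0 \<le> ord_at W f + D W)}"

text \<open>The value \<open>f(W) \<in> K\<close> of a function regular at the closed point \<open>W\<close>.\<close>

definition value_at :: "('k :: field \<Rightarrow> 'f :: field) \<Rightarrow> 'f set \<Rightarrow> 'f \<Rightarrow> 'k" where
  "value_at \<iota> W f = (THE c. f - \<iota> c \<in> nonunits W)"

section \<open>Semistable models\<close>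

text \<open>An integral scheme with function field \<open>F\<close>, separated and of finite type over the valuation
  ring, is described by the set of its local rings inside \<open>F\<close> (a Chevalley scheme, or a model in
  the sense of Zariski and Nagata). A flat model of an integral curve is integral, and integral
  models are flat since torsion-free modules over a valuation ring are flat.\<close>

definition dominates :: "'f :: field set \<Rightarrow> 'f set \<Rightarrow> bool" where
  "dominates W R \<longleftrightarrow> R \<subseteq> W \<and> nonunits R \<subseteq> nonunits W"

definition localization_at :: "'f :: field set \<Rightarrow> 'f set \<Rightarrow> 'f set" where
  "localization_at A P = {a / b | a b. a \<in> A \<and> b \<in> A - P}"

definition spec_local_rings :: "'f :: field set \<Rightarrow> 'f set set" where
  "spec_local_rings A = {localization_at A P | P. primeideal P (subring_rec A)}"

text \<open>The final clause is properness and separatedness by the valuative criterion.\<close>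

definition proper_model :: "('k :: field \<Rightarrow> ereal) \<Rightarrow> ('k \<Rightarrow> 'f :: field) \<Rightarrow> 'f set set \<Rightarrow> bool" where
  "proper_model val \<iota> \<XX> \<longleftrightarrow>
     (\<exists>\<A>. finite \<A> \<and> \<XX> = (\<Union>A\<in>\<A>. spec_local_rings A) \<and>
        (\<forall>A\<in>\<A>. (\<exists>S. finite S \<and> A = generate_ring ring_of_type_algebra (\<iota> ` val_ring val \<union> S)) \<and>
                localization_at A {0} = UNIV)) \<and>
     (\<forall>W. valuation_subring W \<and> \<iota> ` val_ring val \<subseteq> W \<longrightarrow> (\<exists>!R. R \<in> \<XX> \<and> dominates W R))"

definition special_points :: "('k :: field \<Rightarrow> ereal) \<Rightarrow> ('k \<Rightarrow> 'f :: field) \<Rightarrow> 'f set set \<Rightarrow> 'f set set" where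
  "special_points val \<iota> \<XX> = {R \<in> \<XX>. \<iota> ` val_ideal val \<subseteq> nonunits R}"

text \<open>A component of the special fiber is represented by the local ring at its generic point.\<close>

definition special_components :: "('k :: field \<Rightarrow> ereal) \<Rightarrow> ('k \<Rightarrow> 'f :: field) \<Rightarrow> 'f set set \<Rightarrow> 'f set set" where
  "special_components val \<iota> \<XX> =
     {C \<in> special_points val \<iota> \<XX>. \<forall>R\<in>special_points val \<iota> \<XX>. C \<subseteq> R \<longrightarrow> R = C}"

subsection \<open>Nodes\<close>

text \<open>\<open>O[[x,y]]\<close>, for the valuation ring \<open>O\<close>, consists of the series with coefficients in \<open>O\<close>; the
  coefficient of \<open>x^i y^j\<close> in \<open>h\<close> is \<open>coeff2 h i j\<close>.\<close>

definition coeff2 :: "'k :: zero fps fps \<Rightarrow> nat \<Rightarrow> nat \<Rightarrow> 'k" where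
  "coeff2 h i j = fps_nth (fps_nth h j) i"

definition fps2_const :: "'k :: zero \<Rightarrow> 'k fps fps" where
  "fps2_const c = fps_const (fps_const c)"

definition fps2_x :: "'k :: comm_ring_1 fps fps" where
  "fps2_x = fps_const fps_X"

definition fps2_y :: "'k :: comm_ring_1 fps fps" where
  "fps2_y = fps_X"

definition fps2_int :: "('k :: field \<Rightarrow> ereal) \<Rightarrow> 'k fps fps set" where
  "fps2_int val = {h. \<forall>i j. coeff2 h i j \<in> val_ring val}"

definition node_ideal :: "('k :: field \<Rightarrow> ereal) \<Rightarrow> 'k \<Rightarrow> 'k fps fps set" where
  "node_ideal val t = Idl\<^bsub>subring_rec (fps2_int val)\<^esub> {fps2_x * fps2_y - fps2_const t}"

primrec ideal_power :: "('a, 'm) ring_scheme \<Rightarrow> 'a set \<Rightarrow> nat \<Rightarrow> 'a set" where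
  "ideal_power R I 0 = carrier R"
| "ideal_power R I (Suc n) = ideal_power R I n \<cdot>\<^bsub>R\<^esub> I"

text \<open>\<open>\<Phi>\<close> identifies the completion of the local ring \<open>R\<close> with \<open>O[[x,y]]/(xy - t)\<close>. The class of
  \<open>\<Phi> f\<close> is what matters; as representative we take the unique one without mixed monomials.
  Completions are taken with respect to a finitely generated ideal \<open>(a, u, v)\<close> whose radical is the
  maximal ideal (the maximal ideal itself is not finitely generated and would give the wrong
  topology); the last two lines say that \<open>R/(a,u,v)^n \<rightarrow> O[[x,y]]/((a,x,y)^n + (xy - t))\<close> is
  bijective for all \<open>n\<close>.\<close>

definition node_coordinates ::
  "('k :: field \<Rightarrow> ereal) \<Rightarrow> ('k \<Rightarrow> 'f :: field) \<Rightarrow> 'f set \<Rightarrow> 'k \<Rightarrow> ('f \<Rightarrow> 'k fps fps) \<Rightarrow> bool" where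
  "node_coordinates val \<iota> R t \<Phi> \<longleftrightarrow>
     t \<noteq> 0 \<and> t \<in> val_ideal val \<and>
     (\<forall>f\<in>R. \<Phi> f \<in> fps2_int val \<and> (\<forall>i j. 0 < i \<and> 0 < j \<longrightarrow> coeff2 (\<Phi> f) i j = 0)) \<and>
     (\<forall>c\<in>val_ring val. \<Phi> (\<iota> c) = fps2_const c) \<and>
     (\<forall>f\<in>R. \<forall>g\<in>R. \<Phi> (f + g) = \<Phi> f + \<Phi> g \<and> \<Phi> (f * g) - \<Phi> f * \<Phi> g \<in> node_ideal val t) \<and>
     (\<exists>a\<in>val_ideal val. \<exists>u\<in>R. \<exists>v\<in>R. a \<noteq> 0 \<and>
        (let OXY = subring_rec (fps2_int val);
             I = (\<lambda>n. ideal_power (subring_rec R) (Idl\<^bsub>subring_rec R\<^esub> {\<iota> a, u, v}) n);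
             J = (\<lambda>n. ideal_power OXY (Idl\<^bsub>OXY\<^esub> {fps2_const a, fps2_x, fps2_y}) n
                       <+>\<^bsub>OXY\<^esub> node_ideal val t)
         in (\<forall>n. \<forall>f\<in>R. f \<in> I n \<longleftrightarrow> \<Phi> f \<in> J n) \<and>
            (\<forall>n. \<forall>h\<in>fps2_int val. \<exists>f\<in>R. h - \<Phi> f \<in> J n)))"

definition nodes :: "('k :: field \<Rightarrow> ereal) \<Rightarrow> ('k \<Rightarrow> 'f :: field) \<Rightarrow> 'f set set \<Rightarrow> 'f set set" where
  "nodes val \<iota> \<XX> = {R \<in> special_points val \<iota> \<XX>. \<exists>t \<Phi>. node_coordinates val \<iota> R t \<Phi>}"

text \<open>The closed points of the special fiber whose local ring in the special fiber is regular, i.e.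
  has a principal maximal ideal.\<close>

definition smooth_special_points ::
  "('k :: field \<Rightarrow> ereal) \<Rightarrow> ('k \<Rightarrow> 'f :: field) \<Rightarrow> 'f set set \<Rightarrow> 'f set set" where
  "smooth_special_points val \<iota> \<XX> =
     {R \<in> special_points val \<iota> \<XX> - special_components val \<iota> \<XX>.
        \<exists>w\<in>R. nonunits R = Idl\<^bsub>subring_rec R\<^esub> (insert w (\<iota> ` val_ideal val))}"

text \<open>The generic fiber is the curve itself, whose generic point has local ring \<open>UNIV\<close>. The third
  clause says that the special fiber is reduced at its generic points.\<close>

definition semistable_model :: "('k :: field \<Rightarrow> ereal) \<Rightarrow> ('k \<Rightarrow> 'f :: field) \<Rightarrow> 'f set set \<Rightarrow> bool" where
  "semistable_model val \<iota> \<XX> \<longleftrightarrow>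
     proper_model val \<iota> \<XX> \<and>
     {R \<in> \<XX>. range \<iota> \<subseteq> R} = insert UNIV (closed_points \<iota>) \<and>
     (\<forall>C\<in>special_components val \<iota> \<XX>. nonunits C = Idl\<^bsub>subring_rec C\<^esub> (\<iota> ` val_ideal val)) \<and>
     special_points val \<iota> \<XX> \<subseteq>
       special_components val \<iota> \<XX> \<union> smooth_special_points val \<iota> \<XX> \<union> nodes val \<iota> \<XX>"

section \<open>Skeleta and tropicalization\<close>

text \<open>The monomial valuation with \<open>v(x) = s\<close> and \<open>v(y) = l - s\<close>.\<close>

definition monomial_val :: "('k :: field \<Rightarrow> ereal) \<Rightarrow> real \<Rightarrow> real \<Rightarrow> 'k fps fps \<Rightarrow> ereal" where
  "monomial_val val l s h = (INF (i, j). val (coeff2 h i j) + ereal (real i * s + real j * (l - s)))"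

text \<open>The skeleton \<open>G\<close> of the model \<open>\<XX>\<close>, where \<open>\<nu> p\<close> is the valuation on \<open>F\<close> corresponding to
  \<open>p\<close>. At a vertex it is the one whose valuation ring is the local ring of the component; on the
  edge of a node with coordinates \<open>\<Phi> R\<close> it is the monomial valuation. The formula at the ends of
  the closed edge determines the incidence.\<close>

definition is_skeleton ::
  "('k :: field \<Rightarrow> ereal) \<Rightarrow> ('k \<Rightarrow> 'f :: field) \<Rightarrow> 'f set set \<Rightarrow> ('f set \<Rightarrow> 'k) \<Rightarrow>
   ('f set \<Rightarrow> 'f \<Rightarrow> 'k fps fps) \<Rightarrow> ('f set, 'f set) mgraph \<Rightarrow>
   (('f set, 'f set) mpoint \<Rightarrow> 'f \<Rightarrow> ereal) \<Rightarrow> bool" where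
  "is_skeleton val \<iota> \<XX> t \<Phi> G \<nu> \<longleftrightarrow>
     wf_mgraph G \<and> verts G = special_components val \<iota> \<XX> \<and> edges G = nodes val \<iota> \<XX> \<and>
     (\<forall>p\<in>points G. field_valuation (\<nu> p) \<and> (\<forall>c. \<nu> p (\<iota> c) = val c)) \<and>
     (\<forall>C\<in>verts G. {f. 0 \<le> \<nu> (Vertex C) f} = C) \<and>
     (\<forall>R\<in>edges G. node_coordinates val \<iota> R (t R) (\<Phi> R) \<and> ereal (len G R) = val (t R) \<and>
        (\<forall>s\<in>{0..len G R}. \<forall>f\<in>R. \<nu> (edge_pt G R s) f = monomial_val val (len G R) s (\<Phi> R f)))"

text \<open>The retraction of a closed point \<open>W\<close> of the curve to the skeleton. Its reduction \<open>R\<close> is the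
  point of the model dominated by the valuation ring of functions with integral value at \<open>W\<close>. If
  \<open>R\<close> is a smooth point of the special fiber, then \<open>W\<close> retracts to the component of \<open>R\<close>. If \<open>R\<close> is a
  node, then \<open>W\<close> lies in the annulus \<open>0 < val x < val t\<close>, and it retracts to the point at distance
  \<open>val (x(W))\<close>; here \<open>\<xi>\<close> is the coordinate \<open>x(W)\<close>, so that \<open>t/\<xi>\<close> is \<open>y(W)\<close>.\<close>

definition retracts_to ::
  "('k :: field \<Rightarrow> ereal) \<Rightarrow> ('k \<Rightarrow> 'f :: field) \<Rightarrow> 'f set set \<Rightarrow> ('f set \<Rightarrow> 'k) \<Rightarrow>
   ('f set \<Rightarrow> 'f \<Rightarrow> 'k fps fps) \<Rightarrow> ('f set, 'f set) mgraph \<Rightarrow>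
   'f set \<Rightarrow> ('f set, 'f set) mpoint \<Rightarrow> bool" where
  "retracts_to val \<iota> \<XX> t \<Phi> G W p \<longleftrightarrow>
     (\<exists>R\<in>\<XX>. dominates {f \<in> W. value_at \<iota> W f \<in> val_ring val} R \<and>
        (R \<in> smooth_special_points val \<iota> \<XX> \<and> (\<exists>C\<in>special_components val \<iota> \<XX>. R \<subseteq> C \<and> p = Vertex C) \<or>
         R \<in> nodes val \<iota> \<XX> \<and>
           (\<exists>\<xi>. 0 < val \<xi> \<and> val \<xi> < val (t R) \<and> p = edge_pt G R (real_of_ereal (val \<xi>)) \<and>
              (\<forall>f\<in>R. (\<lambda>N. val (value_at \<iota> W f -
                  (\<Sum>i\<le>N. \<Sum>j\<le>N. coeff2 (\<Phi> R f) i j * \<xi> ^ i * (t R / \<xi>) ^ j))) \<longlonglongrightarrow> \<infinity>))))"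

text \<open>The vertices of the skeleton need not correspond to the vertices of the chosen combinatorial
  model of \<open>\<Gamma>\<close>, so the two are identified by an isometry \<open>\<theta>\<close>. The field \<open>K\<close> and the function
  field range over the types given by the first two arguments.\<close>

definition realizable_series ::
  "'k :: alg_closed_field itself \<Rightarrow> 'f :: field itself \<Rightarrow>
   ('v, 'e) mgraph \<Rightarrow> (('v, 'e) mpoint \<Rightarrow> int) \<Rightarrow> nat \<Rightarrow> (('v, 'e) mpoint \<Rightarrow> real) set \<Rightarrow> bool" where
  "realizable_series _ _ \<Gamma> D r \<Sigma> \<longleftrightarrow>
     (\<exists>(val :: 'k \<Rightarrow> ereal) (\<iota> :: 'k \<Rightarrow> 'f) \<XX> t \<Phi> G \<nu> \<theta> D\<^sub>X V.
        base_field val \<and> function_field \<iota> \<and> semistable_model val \<iota> \<XX> \<and>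
        is_skeleton val \<iota> \<XX> t \<Phi> G \<nu> \<and> mgraph_isometry \<Gamma> G \<theta> \<and>
        D\<^sub>X \<in> divisors (closed_points \<iota>) \<and>
        (\<forall>p\<in>points \<Gamma>. D p = (\<Sum>W | D\<^sub>X W \<noteq> 0 \<and> retracts_to val \<iota> \<XX> t \<Phi> G W (\<theta> p). D\<^sub>X W)) \<and>
        V \<subseteq> riemann_roch_space \<iota> D\<^sub>X \<and>
        module.subspace (\<lambda>c f. \<iota> c * f) V \<and> vector_space.dim (\<lambda>c f. \<iota> c * f) V = r + 1 \<and>
        \<Sigma> = (\<lambda>f. \<lambda>p\<in>points \<Gamma>. real_of_ereal (\<nu> (\<theta> p) f)) ` (V - {0}))"

end

theory Submission
  imports Defs
begin

text \<open>On the edges of the Levi graph a function of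
  \<open>R(D\<^sub>M)\<close> is concave, and since every \<open>e \<in> E\<close> carries one chip only, the locus where it attains
  its minimum is very restricted: if it is not minimal at \<open>x \<in> E\<close>, then it is minimal at a line \<open>F\<close>
  iff \<open>x \<notin> F\<close>. The Brill-Noether condition for the divisor \<open>2x\<close> provides an \<open>f\<^sub>x \<in> V\<close> of this kind.
  Normalize \<open>f\<^sub>x\<close> to have minimum \<open>0\<close> and let \<open>\<mu>\<^sub>F\<close> be the valuation at the vertex \<open>F\<close>; then
  \<open>\<mu>\<^sub>F(f\<^sub>x) > 0\<close> if \<open>x \<in> F\<close>, and \<open>\<mu>\<^sub>F(f\<^sub>x) = 0\<close> otherwise. These valuations detect dependence modulo
  the maximal ideal: the functions \<open>f\<^sub>b\<close>, for \<open>b\<close> in a basis of \<open>M\<close>, form a basis of \<open>V\<close>, the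
  coordinates of the \<open>f\<^sub>x\<close> are integral, and their residues realize \<open>M\<close> over the residue field of \<open>K\<close>.
  Of the geometry of the curve only these valuations are used.\<close>

section \<open>Lines of a simple matroid of rank 3\<close>

context matroid
begin

lemma finite_indep_subsets: "finite {T. T \<subseteq> S \<and> indep T}"
  by (rule finite_subset[of _ "Pow E"]) (auto dest: indep_ground simp: finite_ground)

lemma card_le_mrank: "T \<subseteq> S \<Longrightarrow> indep T \<Longrightarrow> card T \<le> mrank indep S"
  unfolding mrank_def using finite_indep_subsets by (intro Max_ge) auto

lemma mrank_attained: obtains T where "T \<subseteq> S" "indep T" "card T = mrank indep S"
proof -
  have "Max (card ` {T. T \<subseteq> S \<and> indep T}) \<in> card ` {T. T \<subseteq> S \<and> indep T}"
    using finite_indep_subsets indep_empty by (intro Max_in) auto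
  then show ?thesis using that unfolding mrank_def by auto
qed

lemma finite_indep: "indep S \<Longrightarrow> finite S"
  using indep_ground finite_ground finite_subset by blast

lemma indep_extend:
  assumes "indep S" and "card S \<le> n" and "n \<le> mrank indep E"
  obtains T where "S \<subseteq> T" "indep T" "card T = n"
proof -
  have "\<exists>T. S \<subseteq> T \<and> indep T \<and> card T = n"
    using assms(2,3)
  proof (induction n rule: dec_induct)
    case base
    then show ?case using assms(1) by blast
  next
    case (step m)
    then obtain T where T: "S \<subseteq> T" "indep T" "card T = m" by auto
    obtain U where U: "indep U" "card U = mrank indep E" by (rule mrank_attained)
    then obtain x where "x \<in> U - T" "indep (insert x T)"
      using indep_augment[of T U] T step.prems by auto
    moreover from this have "card (insert x T) = Suc m"
      using T finite_indep[of T] by simp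
    ultimately show ?case using T by blast
  qed
  then show ?thesis using that by blast
qed

end

section \<open>Incidence geometry of points and rank 2 flats\<close>

locale simple_rank3_matroid = matroid +
  assumes indep_pair: "x \<in> E \<Longrightarrow> y \<in> E \<Longrightarrow> indep {x, y}"
    and mrank_ground: "mrank indep E = 3"
begin

abbreviation lines :: "'a set set" where
  "lines \<equiv> flats E indep 2"

text \<open>The closure of a pair. The points \<open>x\<close> and \<open>y\<close> are added
  separately because for \<open>z = x\<close> or \<open>z = y\<close> the set
  \<open>{x, y, z}\<close> collapses to a pair, which is independent.\<close>

definition line :: "'a \<Rightarrow> 'a \<Rightarrow> 'a set" where
  "line x y = {x, y} \<union> {z \<in> E. \<not> indep {x, y, z}}"

lemma card_indep_le: "indep S \<Longrightarrow> card S \<le> 3"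
  using card_le_mrank[of S E] indep_ground mrank_ground by simp

lemma line_subset: "x \<in> E \<Longrightarrow> y \<in> E \<Longrightarrow> line x y \<subseteq> E"
  by (auto simp: line_def)

lemma lines_subset: "F \<in> lines \<Longrightarrow> F \<subseteq> E"
  by (simp add: flats_def)

lemma finite_lines: "finite lines"
  by (rule finite_subset[of _ "Pow E"]) (auto simp: flats_def finite_ground)

text \<open>An independent triple inside the line would augment \<open>{x, y}\<close> by a third
  point of the line, which the definition of \<open>line\<close> rules out. A point outside extends
  \<open>{x, y}\<close> to an independent triple, so it raises the rank.\<close>

lemma line_in_lines:
  assumes "x \<in> E" "y \<in> E" "x \<noteq> y"
  shows "line x y \<in> lines"
proof -
  have xy: "indep {x, y}" using assms indep_pair by blast
  have "mrank indep (line x y) = 2"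
  proof (rule antisym)
    obtain T where T: "T \<subseteq> line x y" "indep T" "card T = mrank indep (line x y)"
      by (rule mrank_attained)
    show "mrank indep (line x y) \<le> 2"
    proof (rule ccontr)
      assume "\<not> ?thesis"
      then obtain z where "z \<in> T - {x, y}" "indep (insert z {x, y})"
        using indep_augment[OF xy T(2)] T(3) assms(3) by auto
      then show False using T(1) by (auto simp: line_def insert_commute)
    qed
    show "2 \<le> mrank indep (line x y)"
      using card_le_mrank[of "{x, y}" "line x y"] xy assms(3) by (simp add: line_def)
  qed
  moreover have "2 < mrank indep (insert z (line x y))" if "z \<in> E - line x y" for z
  proof -
    have "indep {x, y, z}" "z \<noteq> x" "z \<noteq> y" using that by (auto simp: line_def)
    then show ?thesis
      using card_le_mrank[of "{x, y, z}" "insert z (line x y)"] assms(3) by (simp add: line_def)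
  qed
  ultimately show ?thesis using line_subset assms by (simp add: flats_def)
qed

text \<open>Rank 2 makes every triple in \<open>F\<close> dependent. Conversely, adjoining a point
  \<open>z\<close> outside \<open>F\<close> raises the rank, so \<open>{x, y}\<close> can be
  augmented by some \<open>w\<close> in \<open>insert z F\<close>; neither a point of
  \<open>F\<close> nor a point \<open>z\<close> of \<open>line x y\<close> can be this
  \<open>w\<close>.\<close>

lemma line_unique:
  assumes F: "F \<in> lines" and xy: "x \<in> F" "y \<in> F" "x \<noteq> y"
  shows "F = line x y"
proof
  have FE: "F \<subseteq> E" and rk: "mrank indep F = 2"
    and fl: "\<And>z. z \<in> E - F \<Longrightarrow> 2 < mrank indep (insert z F)"
    using F by (auto simp: flats_def)
  have ixy: "indep {x, y}" using xy FE indep_pair by blast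
  have three: "\<not> indep {x, y, z}" if "z \<in> F" "z \<noteq> x" "z \<noteq> y" for z
    using card_le_mrank[of "{x, y, z}" F] that xy rk by auto
  show "F \<subseteq> line x y"
    using three FE by (auto simp: line_def)
  show "line x y \<subseteq> F"
  proof
    fix z assume z: "z \<in> line x y"
    show "z \<in> F"
    proof (rule ccontr)
      assume nz: "z \<notin> F"
      then have zE: "z \<in> E" "\<not> indep {x, y, z}" "z \<noteq> x" "z \<noteq> y" using z xy by (auto simp: line_def)
      obtain T where T: "T \<subseteq> insert z F" "indep T" "card T = mrank indep (insert z F)"
        by (rule mrank_attained)
      then obtain w where w: "w \<in> T - {x, y}" "indep (insert w {x, y})"
        using indep_augment[OF ixy T(2)] xy(3) fl[of z] zE nz by auto
      then have "indep {x, y, w}" by (simp add: insert_commute)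
      then show False using w T(1) zE three[of w] by auto
    qed
  qed
qed

lemma line_has_two_points:
  assumes "F \<in> lines" obtains x y where "x \<in> F" "y \<in> F" "x \<noteq> y"
proof -
  obtain T where T: "T \<subseteq> F" "indep T" "card T = mrank indep F" by (rule mrank_attained)
  then have "card T = 2" using assms by (simp add: flats_def)
  then obtain x y where "T = {x, y}" "x \<noteq> y" by (auto simp: card_2_iff)
  then show ?thesis using T(1) that[of x y] by blast
qed

lemma point_off_line:
  assumes "F \<in> lines" obtains x where "x \<in> E" "x \<notin> F"
proof -
  have "F \<noteq> E" using assms mrank_ground by (auto simp: flats_def)
  then show ?thesis using that lines_subset[OF assms] by blast
qed

text \<open>Extend \<open>S\<close> to a basis; its two points other than \<open>x\<close> span the
  required line. Later this line isolates one term of a linear combination.\<close>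

lemma indep_imp_line:
  assumes S: "indep S" and x: "x \<in> S"
  obtains F where "F \<in> lines" "S - {x} \<subseteq> F" "x \<notin> F"
proof -
  obtain T where T: "S \<subseteq> T" "indep T" "card T = 3"
    using indep_extend[OF S, of 3] card_indep_le[OF S] mrank_ground by auto
  have "card (T - {x}) = 2" using T x finite_indep[of T] by (simp add: subset_iff)
  then obtain y z where yz: "T - {x} = {y, z}" "y \<noteq> z" by (auto simp: card_2_iff)
  then have eq: "T = {y, z, x}" and nx: "x \<noteq> y" "x \<noteq> z" using T x by auto
  have E: "y \<in> E" "z \<in> E" using indep_ground[OF T(2)] eq by auto
  show ?thesis
  proof
    show "line y z \<in> lines" using line_in_lines E yz by blast
    show "S - {x} \<subseteq> line y z" using T(1) yz by (auto simp: line_def)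
    show "x \<notin> line y z" using T(2) eq nx by (auto simp: line_def)
  qed
qed

lemma line_separating:
  assumes "x \<in> E" "y \<in> E" "x \<noteq> y"
  obtains F where "F \<in> lines" "x \<in> F" "y \<notin> F"
proof -
  obtain F where "F \<in> lines" "{x, y} - {y} \<subseteq> F" "y \<notin> F"
    using indep_imp_line[OF indep_pair[OF assms(1,2)], of y] by blast
  then show ?thesis using that assms(3) by blast
qed

lemma two_lines_through:
  assumes "x \<in> E"
  obtains F F' where "F \<in> lines" "F' \<in> lines" "x \<in> F" "x \<in> F'" "F \<noteq> F'"
proof -
  obtain T where T: "{x} \<subseteq> T" "indep T" "card T = 3"
    using indep_extend[of "{x}" 3] indep_pair[OF assms assms] mrank_ground by auto
  then have "card (T - {x}) = 2" using finite_indep[of T] by simp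
  then obtain y z where yz: "T - {x} = {y, z}" "y \<noteq> z" by (auto simp: card_2_iff)
  have E: "y \<in> E" "y \<noteq> x" "z \<in> E" "z \<noteq> x" using indep_ground[OF T(2)] yz by auto
  have "indep {x, y, z}" using T yz by (metis insert_Diff insert_subset)
  then have "z \<notin> line x y" using E yz by (auto simp: line_def)
  moreover have "z \<in> line x z" by (simp add: line_def)
  ultimately show ?thesis
    using that[of "line x y" "line x z"] line_in_lines assms E by (auto simp: line_def)
qed

end

section \<open>Valuations and residue fields\<close>

text \<open>Its elements are cosets, so it lives on the type \<open>'a set\<close>;
  \<open>realizable_over_any_field\<close> absorbs this change of type at the end.\<close>

definition residue_field :: "('a :: field \<Rightarrow> ereal) \<Rightarrow> 'a set ring" where
  "residue_field v = subring_rec (val_ring v) Quot val_ideal v"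

definition residue :: "('a :: field \<Rightarrow> ereal) \<Rightarrow> 'a \<Rightarrow> 'a set" where
  "residue v x = val_ideal v +>\<^bsub>subring_rec (val_ring v)\<^esub> x"

section \<open>Elementary properties of a valuation\<close>

context
  fixes v :: "'a :: field \<Rightarrow> ereal"
  assumes v: "field_valuation v"
begin

lemma valuation_eq_infinity_iff: "v x = \<infinity> \<longleftrightarrow> x = 0"
  and valuation_neq_minus_infinity: "v x \<noteq> - \<infinity>"
  and valuation_mult: "v (x * y) = v x + v y"
  and valuation_add: "min (v x) (v y) \<le> v (x + y)"
  using v by (auto simp: field_valuation_def)

lemma valuation_zero: "v 0 = \<infinity>"
  by (simp add: valuation_eq_infinity_iff)

lemma valuation_finite: "x \<noteq> 0 \<Longrightarrow> \<exists>r. v x = ereal r"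
  using valuation_eq_infinity_iff[of x] valuation_neq_minus_infinity[of x] by (cases "v x") auto

lemma valuation_one: "v 1 = 0"
proof -
  obtain r where "v 1 = ereal r" using valuation_finite[of 1] by auto
  then show ?thesis using valuation_mult[of 1 1] by simp
qed

lemma valuation_uminus: "v (- x) = v x"
proof -
  obtain r where r: "v (- 1) = ereal r" using valuation_finite[of "- 1"] by auto
  then have "v (- 1) = 0" using valuation_mult[of "- 1" "- 1"] valuation_one by simp
  then show ?thesis using valuation_mult[of "- 1" x] by simp
qed

lemma valuation_inverse:
  assumes "x \<noteq> 0" shows "v (inverse x) = - v x"
proof -
  obtain r s where "v x = ereal r" "v (inverse x) = ereal s"
    using valuation_finite[of x] valuation_finite[of "inverse x"] assms by auto
  then show ?thesis using valuation_mult[of x "inverse x"] valuation_one assms by simp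
qed

text \<open>The bound \<open>r < \<infinity>\<close> serves the empty sum, whose valuation is
  infinite.\<close>

lemma valuation_sum_gr:
  "finite S \<Longrightarrow> r < \<infinity> \<Longrightarrow> (\<And>i. i \<in> S \<Longrightarrow> r < v (g i)) \<Longrightarrow> r < v (\<Sum>i\<in>S. g i)"
proof (induction S rule: finite_induct)
  case (insert i S)
  then have "r < min (v (g i)) (v (\<Sum>i\<in>S. g i))" by simp
  also have "\<dots> \<le> v (g i + (\<Sum>i\<in>S. g i))" by (rule valuation_add)
  finally show ?case using insert by simp
qed (simp add: valuation_zero)

text \<open>Otherwise \<open>x\<close>, as the sum of \<open>x + y\<close> and \<open>- y\<close>,
  would have a valuation larger than its own.\<close>

lemma valuation_add_le:
  assumes "v x < v y" shows "v (x + y) \<le> v x"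
proof (rule ccontr)
  assume "\<not> ?thesis"
  then have "v x < min (v (x + y)) (v (- y))" using assms by (simp add: valuation_uminus)
  also have "\<dots> \<le> v (x + y + - y)" by (rule valuation_add)
  finally show False by simp
qed

section \<open>The residue field and linear independence over it\<close>

lemma subring_val_ring: "subring (val_ring v) ring_of_type_algebra"
proof -
  interpret ring "ring_of_type_algebra :: 'a ring" by (rule ring_from_type_algebra)
  have minus: "\<ominus>\<^bsub>ring_of_type_algebra\<^esub> x = - x" for x :: 'a
    using minus_equality[of "- x" x] by (simp add: ring_of_type_algebra_def)
  show ?thesis
  proof (rule subringI)
    fix x y assume "x \<in> val_ring v" "y \<in> val_ring v"
    then show "x \<oplus>\<^bsub>ring_of_type_algebra\<^esub> y \<in> val_ring v"
      "x \<otimes>\<^bsub>ring_of_type_algebra\<^esub> y \<in> val_ring v"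
      using valuation_add[of x y] valuation_mult[of x y]
      by (auto simp: val_ring_def ring_of_type_algebra_def intro: order_trans[rotated] split: if_splits)
  qed (auto simp: minus, auto simp: val_ring_def ring_of_type_algebra_def valuation_uminus valuation_one)
qed

lemma cring_val_ring: "cring (subring_rec (val_ring v))"
proof -
  interpret cring "ring_of_type_algebra :: 'a ring" by (rule cring_from_type_algebra)
  show ?thesis
    using subcringI'[OF subring_val_ring] subcring_iff[of "val_ring v"]
    by (simp add: ring_of_type_algebra_def)
qed

text \<open>An integral element outside \<open>val_ideal v\<close> has valuation 0, so its inverse
  is integral too, and an ideal containing it is the whole ring.\<close>

lemma maximalideal_val_ideal: "maximalideal (val_ideal v) (subring_rec (val_ring v))"
proof (rule maximalidealI)
  let ?O = "subring_rec (val_ring v)"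
  interpret O: cring ?O by (rule cring_val_ring)
  note ops = val_ring_def val_ideal_def ring_of_type_algebra_def
  have minus: "\<ominus>\<^bsub>?O\<^esub> x = - x" if "0 \<le> v x" for x
    using O.minus_equality[of "- x" x] that by (simp add: ops valuation_uminus)
  show "ideal (val_ideal v) ?O"
  proof (rule idealI)
    show "subgroup (val_ideal v) (add_monoid ?O)"
    proof (rule O.add.subgroupI)
      fix x y assume xy: "x \<in> val_ideal v" "y \<in> val_ideal v"
      then have "0 < min (v x) (v y)" by (simp add: ops)
      also have "\<dots> \<le> v (x + y)" by (rule valuation_add)
      finally show "x \<oplus>\<^bsub>?O\<^esub> y \<in> val_ideal v" by (simp add: ops)
    next
      fix x assume "x \<in> val_ideal v"
      then show "\<ominus>\<^bsub>?O\<^esub> x \<in> val_ideal v"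
        using minus[of x] by (simp add: val_ideal_def valuation_uminus)
    qed (auto simp: ops intro!: exI[of _ 0] simp: valuation_zero)
  next
    fix a x assume ax: "a \<in> val_ideal v" "x \<in> carrier ?O"
    then have "0 < v a + v x"
      using valuation_neq_minus_infinity[of x] valuation_neq_minus_infinity[of a]
      by (intro add_pos_nonneg) (auto simp: ops)
    then show "x \<otimes>\<^bsub>?O\<^esub> a \<in> val_ideal v" "a \<otimes>\<^bsub>?O\<^esub> x \<in> val_ideal v"
      by (simp_all add: ops valuation_mult add.commute)
  qed (rule O.ring_axioms)
  show "carrier ?O \<noteq> val_ideal v"
    using valuation_one by (auto simp: ops set_eq_iff intro!: exI[of _ 1])
  fix J assume J: "ideal J ?O" "val_ideal v \<subseteq> J" "J \<subseteq> carrier ?O"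
  show "J = val_ideal v \<or> J = carrier ?O"
  proof (rule disjCI)
    assume "J \<noteq> carrier ?O"
    have "x \<in> val_ideal v" if "x \<in> J" for x
    proof (rule ccontr)
      assume "x \<notin> val_ideal v"
      then have v0: "v x = 0" using that J(3) by (auto simp: ops)
      then have "x \<noteq> 0" using valuation_zero by auto
      then have "inverse x \<in> carrier ?O" using valuation_inverse v0 by (simp add: ops)
      then have "inverse x \<otimes>\<^bsub>?O\<^esub> x \<in> J" using ideal.I_l_closed[OF J(1) that] by simp
      then have "\<one>\<^bsub>?O\<^esub> \<in> J" using \<open>x \<noteq> 0\<close> by (simp add: ops)
      then show False using ideal.one_imp_carrier[OF J(1)] \<open>J \<noteq> carrier ?O\<close> by blast
    qed
    then show "J = val_ideal v" using J(2) by blast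
  qed
qed

lemma field_residue_field: "field (residue_field v)"
  unfolding residue_field_def
  using maximalideal.quotient_is_field[OF maximalideal_val_ideal cring_val_ring] .

lemma carrier_residue_field: "carrier (residue_field v) = residue v ` val_ring v"
  unfolding residue_field_def residue_def
  by (auto simp: FactRing_def A_RCOSETS_def RCOSETS_def a_r_coset_def)

lemma residue_hom: "ring_hom_cring (subring_rec (val_ring v)) (residue_field v) (residue v)"
  unfolding residue_field_def residue_def[abs_def]
  by (rule ideal.rcos_ring_hom_cring[OF maximalideal.axioms(1)[OF maximalideal_val_ideal] cring_val_ring])

lemma residue_eq_zero_iff:
  assumes "x \<in> val_ring v"
  shows "residue v x = \<zero>\<^bsub>residue_field v\<^esub> \<longleftrightarrow> x \<in> val_ideal v"
proof -
  interpret ideal "val_ideal v" "subring_rec (val_ring v)"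
    by (rule maximalideal.axioms(1)[OF maximalideal_val_ideal])
  show ?thesis
    using a_rcos_const[of x] a_rcos_self[of x] assms
    unfolding residue_field_def residue_def by (auto simp: FactRing_def)
qed

text \<open>Integrality of the sum is carried along because the induction step applies the
  homomorphism laws of \<open>residue v\<close> to it.\<close>

lemma residue_linear_combination:
  assumes "finite S" "\<And>e. e \<in> S \<Longrightarrow> c e \<in> val_ring v" "\<And>e. e \<in> S \<Longrightarrow> x e \<in> val_ring v"
  shows "(\<Oplus>\<^bsub>residue_field v\<^esub>e\<in>S. residue v (c e) \<otimes>\<^bsub>residue_field v\<^esub> residue v (x e)) = residue v (\<Sum>e\<in>S. c e * x e)
    \<and> (\<Sum>e\<in>S. c e * x e) \<in> val_ring v"
proof -
  interpret h: ring_hom_cring "subring_rec (val_ring v)" "residue_field v" "residue v" by (rule residue_hom)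
  have ops: "x \<oplus>\<^bsub>subring_rec (val_ring v)\<^esub> y = x + y" "x \<otimes>\<^bsub>subring_rec (val_ring v)\<^esub> y = x * y"
    "\<zero>\<^bsub>subring_rec (val_ring v)\<^esub> = 0" "carrier (subring_rec (val_ring v)) = val_ring v" "x \<oplus>\<^bsub>ring_of_type_algebra\<^esub> y = x + y"
    "x \<otimes>\<^bsub>ring_of_type_algebra\<^esub> y = x * y" for x y :: 'a
    by (simp_all add: ring_of_type_algebra_def)
  show ?thesis
    using assms
  proof (induction S rule: finite_induct)
    case empty
    then show ?case using h.hom_zero h.R.zero_closed by (simp add: ops)
  next
    case (insert e S)
    have cl: "c e * x e \<in> val_ring v" "(\<Sum>e\<in>S. c e * x e) \<in> val_ring v"
      using h.R.m_closed[of "c e" "x e"] insert by (simp_all add: ops)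
    have "(\<lambda>e. residue v (c e) \<otimes>\<^bsub>residue_field v\<^esub> residue v (x e)) \<in> insert e S \<rightarrow> carrier (residue_field v)"
      using insert.prems h.hom_closed by (auto simp: ops)
    then have "(\<Oplus>\<^bsub>residue_field v\<^esub>e\<in>insert e S. residue v (c e) \<otimes>\<^bsub>residue_field v\<^esub> residue v (x e))
      = residue v (c e) \<otimes>\<^bsub>residue_field v\<^esub> residue v (x e) \<oplus>\<^bsub>residue_field v\<^esub> residue v (\<Sum>e\<in>S. c e * x e)"
      using insert by (subst h.S.finsum_insert) auto
    also have "\<dots> = residue v (c e * x e + (\<Sum>e\<in>S. c e * x e))"
      using h.hom_mult[of "c e" "x e"] h.hom_add[of "c e * x e" "\<Sum>e\<in>S. c e * x e"] cl insert.prems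
      by (simp add: ops)
    finally show ?case
      using h.R.a_closed[of "c e * x e" "\<Sum>e\<in>S. c e * x e"] cl insert.hyps by (simp add: ops)
  qed
qed

text \<open>Every element of the residue field has an integral lift, so independence can be tested
  on lifts, computing modulo the maximal ideal. The later arguments thereby stay inside the valued
  field.\<close>

lemma lin_indep_family_residue_iff:
  assumes "finite S" and x: "\<And>e i. e \<in> S \<Longrightarrow> i < n \<Longrightarrow> x e i \<in> val_ring v"
  shows "lin_indep_family (residue_field v) n (\<lambda>e i. residue v (x e i)) S \<longleftrightarrow>
    (\<forall>c. (\<forall>e\<in>S. c e \<in> val_ring v) \<longrightarrow> (\<forall>i<n. (\<Sum>e\<in>S. c e * x e i) \<in> val_ideal v) \<longrightarrow>
      (\<forall>e\<in>S. c e \<in> val_ideal v))" (is "?L \<longleftrightarrow> ?R")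
proof -
  have eq: "(\<forall>i<n. (\<Oplus>\<^bsub>residue_field v\<^esub>e\<in>S. d e \<otimes>\<^bsub>residue_field v\<^esub> residue v (x e i)) = \<zero>\<^bsub>residue_field v\<^esub>)
      \<longleftrightarrow> (\<forall>i<n. (\<Sum>e\<in>S. c e * x e i) \<in> val_ideal v)"
    "(\<forall>e\<in>S. d e = \<zero>\<^bsub>residue_field v\<^esub>) \<longleftrightarrow> (\<forall>e\<in>S. c e \<in> val_ideal v)"
    if c: "\<forall>e\<in>S. c e \<in> val_ring v" and d: "\<forall>e\<in>S. d e = residue v (c e)" for c d
  proof -
    interpret R: field "residue_field v" by (rule field_residue_field)
    have mem: "residue v a \<in> carrier (residue_field v)" if "a \<in> val_ring v" for a
      using that by (simp add: carrier_residue_field)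
    have "(\<Oplus>\<^bsub>residue_field v\<^esub>e\<in>S. d e \<otimes>\<^bsub>residue_field v\<^esub> residue v (x e i))
      = residue v (\<Sum>e\<in>S. c e * x e i) \<and> (\<Sum>e\<in>S. c e * x e i) \<in> val_ring v" if "i < n" for i
    proof -
      have "(\<Oplus>\<^bsub>residue_field v\<^esub>e\<in>S. d e \<otimes>\<^bsub>residue_field v\<^esub> residue v (x e i))
        = (\<Oplus>\<^bsub>residue_field v\<^esub>e\<in>S. residue v (c e) \<otimes>\<^bsub>residue_field v\<^esub> residue v (x e i))"
        using c d x that by (intro R.finsum_cong') (auto intro!: R.m_closed simp: carrier_residue_field[symmetric] mem)
      then show ?thesis
        using residue_linear_combination[of S c "\<lambda>e. x e i"] assms c that by simp
    qed
    then show "(\<forall>i<n. (\<Oplus>\<^bsub>residue_field v\<^esub>e\<in>S. d e \<otimes>\<^bsub>residue_field v\<^esub> residue v (x e i)) = \<zero>\<^bsub>residue_field v\<^esub>)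
      \<longleftrightarrow> (\<forall>i<n. (\<Sum>e\<in>S. c e * x e i) \<in> val_ideal v)"
      by (simp add: residue_eq_zero_iff)
    show "(\<forall>e\<in>S. d e = \<zero>\<^bsub>residue_field v\<^esub>) \<longleftrightarrow> (\<forall>e\<in>S. c e \<in> val_ideal v)"
      using c d by (simp add: residue_eq_zero_iff)
  qed
  show ?thesis
  proof
    assume L: ?L
    show ?R
    proof (intro allI impI)
      fix c assume c: "\<forall>e\<in>S. c e \<in> val_ring v" "\<forall>i<n. (\<Sum>e\<in>S. c e * x e i) \<in> val_ideal v"
      have "(\<lambda>e. residue v (c e)) \<in> S \<rightarrow> carrier (residue_field v)"
        using c(1) carrier_residue_field by auto
      note mp[OF bspec[OF L[unfolded lin_indep_family_def] this]]
      then show "\<forall>e\<in>S. c e \<in> val_ideal v"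
        using eq[OF c(1), of "\<lambda>e. residue v (c e)"] c(2) by simp
    qed
  next
    assume R: ?R
    show ?L
      unfolding lin_indep_family_def
    proof (rule ballI, rule impI)
      fix d assume d: "d \<in> S \<rightarrow> carrier (residue_field v)"
        and z: "\<forall>i<n. (\<Oplus>\<^bsub>residue_field v\<^esub>e\<in>S. d e \<otimes>\<^bsub>residue_field v\<^esub> residue v (x e i)) = \<zero>\<^bsub>residue_field v\<^esub>"
      have "\<forall>e\<in>S. \<exists>a. a \<in> val_ring v \<and> d e = residue v a"
        using d carrier_residue_field by (auto simp: Pi_def)
      then obtain c where c: "\<forall>e\<in>S. c e \<in> val_ring v" "\<forall>e\<in>S. d e = residue v (c e)"
        by metis
      show "\<forall>e\<in>S. d e = \<zero>\<^bsub>residue_field v\<^esub>"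
        using R c(1) z eq[OF c] by blast
    qed
  qed
qed

end

section \<open>Realization over the residue field\<close>

text \<open>Positivity of \<open>dim V\<close> guarantees a finite basis, since an infinite one has
  \<open>card\<close> equal to 0.\<close>

lemma (in vector_space) obtain_relation_if_dim_less_card:
  assumes "subspace V" "0 < dim V" "finite T" "T \<subseteq> V" "dim V < card T"
  obtains u where "\<exists>t\<in>T. u t \<noteq> 0" "(\<Sum>t\<in>T. scale (u t) t) = 0"
proof -
  obtain B where B: "B \<subseteq> V" "independent B" "V \<subseteq> span B" "card B = dim V"
    by (rule basis_exists)
  then have "finite B" using assms(2) card_gt_0_iff by metis
  then have "dependent T"
    using independent_span_bound[of B T] B assms by force
  then show ?thesis using that dependent_finite[OF assms(3)] by blast
qed

text \<open>If \<open>f\<close> were outside the span, \<open>insert f T\<close> would be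
  independent with more than \<open>dim V\<close> elements.\<close>

lemma (in vector_space) independent_spans_if_card_eq_dim:
  assumes "subspace V" "0 < dim V" "finite T" "T \<subseteq> V" "dim V = card T" "independent T" "f \<in> V"
  obtains u where "f = (\<Sum>t\<in>T. scale (u t) t)"
proof -
  have "f \<in> span T"
  proof (rule ccontr)
    assume nf: "f \<notin> span T"
    then have "f \<notin> T" using span_base by blast
    obtain u where "\<exists>t\<in>insert f T. u t \<noteq> 0" "(\<Sum>t\<in>insert f T. scale (u t) t) = 0"
      using obtain_relation_if_dim_less_card[of V "insert f T"] assms \<open>f \<notin> T\<close> by auto
    then have "dependent (insert f T)" using assms(3) dependent_finite[of "insert f T"] by auto
    then show False using independent_insertI[OF nf assms(6)] by blast
  qed
  then show ?thesis using that span_finite[OF assms(3)] by auto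
qed

text \<open>The interface between the two halves: the Levi graph supplies \<open>w\<close> and
  \<open>\<mu>\<close>, and from them the matroid is realized by pure algebra.\<close>

locale separating_functions = simple_rank3_matroid +
  fixes val :: "'k :: field \<Rightarrow> ereal" and \<iota> :: "'k \<Rightarrow> 'f :: field" and \<mu> :: "'a set \<Rightarrow> 'f \<Rightarrow> ereal"
    and V :: "'f set" and w :: "'a \<Rightarrow> 'f"
  assumes val: "field_valuation val"
    and vs: "vector_space (\<lambda>c f. \<iota> c * f)"
    and subspace: "module.subspace (\<lambda>c f. \<iota> c * f) V"
    and dim: "vector_space.dim (\<lambda>c f. \<iota> c * f) V = 3"
    and w_in: "e \<in> E \<Longrightarrow> w e \<in> V"
    and valuation: "F \<in> lines \<Longrightarrow> field_valuation (\<mu> F)"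
    and extends: "F \<in> lines \<Longrightarrow> \<mu> F (\<iota> c) = val c"
    and pos: "F \<in> lines \<Longrightarrow> e \<in> F \<Longrightarrow> 0 < \<mu> F (w e)"
    and zero: "F \<in> lines \<Longrightarrow> e \<in> E \<Longrightarrow> e \<notin> F \<Longrightarrow> \<mu> F (w e) = 0"
begin

sublocale vs: vector_space "\<lambda>c f. \<iota> c * f"
  by (rule vs)

lemma \<mu>_scale: "F \<in> lines \<Longrightarrow> \<mu> F (\<iota> c * f) = val c + \<mu> F f"
  using valuation_mult[OF valuation] extends by simp

lemma nonneg: "F \<in> lines \<Longrightarrow> e \<in> E \<Longrightarrow> 0 \<le> \<mu> F (w e)"
  using pos[of F e] zero[of F e] by (cases "e \<in> F") auto

text \<open>Let \<open>a i\<close> have the least valuation, and let \<open>F\<close> contain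
  \<open>S - {i}\<close> but not \<open>i\<close>. At \<open>F\<close> the term of \<open>i\<close>
  has valuation \<open>val (a i)\<close> and all other terms have a larger one, so the sum cannot
  exceed \<open>val (a i)\<close>.\<close>

lemma combination_le:
  assumes S: "indep S" and j: "j \<in> S"
  shows "\<exists>F\<in>lines. \<mu> F (\<Sum>e\<in>S. \<iota> (a e) * w e) \<le> val (a j)"
proof -
  have fin: "finite S" using S by (rule finite_indep)
  have "Min ((\<lambda>e. val (a e)) ` S) \<in> (\<lambda>e. val (a e)) ` S" using fin j by (intro Min_in) auto
  then obtain i where i: "i \<in> S" "val (a i) = Min ((\<lambda>e. val (a e)) ` S)" by auto
  then have min: "val (a i) \<le> val (a e)" if "e \<in> S" for e
    using fin that by simp
  obtain F where F: "F \<in> lines" "S - {i} \<subseteq> F" "i \<notin> F"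
    using indep_imp_line[OF S i(1)] .
  have "i \<in> E" using i S indep_ground by blast
  then have \<mu>i: "\<mu> F (\<iota> (a i) * w i) = val (a i)"
    using \<mu>_scale[OF F(1)] zero F by simp
  have "\<mu> F (\<Sum>e\<in>S. \<iota> (a e) * w e) \<le> val (a i)"
  \<comment> \<open>If the least valuation is infinite, the bound is trivial, whereas the strict
    comparison below needs a finite one.\<close>
  proof (cases "a i = 0")
    case True
    then show ?thesis using valuation_zero[OF val] by simp
  next
    case False
    then obtain r where r: "val (a i) = ereal r" using valuation_finite[OF val] by blast
    have "ereal r < \<mu> F (\<iota> (a e) * w e)" if "e \<in> S - {i}" for e
    proof -
      have "0 < \<mu> F (w e)" using pos F that by blast
      then show ?thesis
        using min[of e] that r \<mu>_scale[OF F(1), of "a e" "w e"]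
        by (cases "val (a e)"; cases "\<mu> F (w e)") auto
    qed
    then have "val (a i) < \<mu> F (\<Sum>e\<in>S - {i}. \<iota> (a e) * w e)"
      using valuation_sum_gr[OF valuation[OF F(1)], of "S - {i}" "ereal r"] fin r by simp
    then have "\<mu> F (\<iota> (a i) * w i + (\<Sum>e\<in>S - {i}. \<iota> (a e) * w e)) \<le> val (a i)"
      using valuation_add_le[OF valuation[OF F(1)], of "\<iota> (a i) * w i"] \<mu>i by simp
    then show ?thesis using sum.remove[OF fin i(1), of "\<lambda>e. \<iota> (a e) * w e"] by simp
  qed
  then show ?thesis using F(1) min[OF j] by (meson order_trans)
qed

lemma inj_on_w: "inj_on w E"
proof (rule inj_onI, rule ccontr)
  fix x y assume xy: "x \<in> E" "y \<in> E" "w x = w y" "x \<noteq> y"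
  obtain F where "F \<in> lines" "x \<in> F" "y \<notin> F" using line_separating[OF xy(1,2,4)] .
  then show False using pos[of F x] zero[of F y] xy by simp
qed

text \<open>By \<open>combination_le\<close>, a vanishing combination has coefficients of infinite
  valuation, so the three functions are independent and span \<open>V\<close>. The same bound makes
  the coordinates of \<open>w e\<close> integral, as \<open>w e\<close> is nonnegative at every
  line.\<close>

lemma combination_basis:
  assumes B: "indep B" "card B = 3" and e: "e \<in> E"
  shows "\<exists>x. w e = (\<Sum>b\<in>B. \<iota> (x b) * w b) \<and> (\<forall>b\<in>B. x b \<in> val_ring val)"
proof -
  have BE: "B \<subseteq> E" and fin: "finite B" using B indep_ground finite_indep by auto
  then have inj: "inj_on w B" using inj_on_w inj_on_subset by blast
  have sum: "(\<Sum>t\<in>w ` B. \<iota> (u t) * t) = (\<Sum>b\<in>B. \<iota> (u (w b)) * w b)" for u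
    using inj by (simp add: sum.reindex)
  have "vs.independent (w ` B)"
  proof -
    have "u (w b) = 0" if z: "(\<Sum>b\<in>B. \<iota> (u (w b)) * w b) = 0" and b: "b \<in> B" for u b
    proof -
      obtain F where "F \<in> lines" "\<mu> F (\<Sum>b\<in>B. \<iota> (u (w b)) * w b) \<le> val (u (w b))"
        using combination_le[OF B(1) b, of "\<lambda>b. u (w b)"] by blast
      then show ?thesis
        using z valuation_zero[OF valuation] valuation_eq_infinity_iff[OF val] by simp
    qed
    then show ?thesis
      using fin vs.dependent_finite[of "w ` B"] sum by auto
  qed
  moreover have "card (w ` B) = 3" using inj B card_image by metis
  ultimately obtain u where "w e = (\<Sum>t\<in>w ` B. \<iota> (u t) * t)"
    using vs.independent_spans_if_card_eq_dim[OF subspace, of "w ` B" "w e"] dim fin w_in BE e by auto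
  then have we: "w e = (\<Sum>b\<in>B. \<iota> (u (w b)) * w b)" using sum by simp
  have "u (w b) \<in> val_ring val" if b: "b \<in> B" for b
  proof -
    obtain F where "F \<in> lines" "\<mu> F (w e) \<le> val (u (w b))"
      using combination_le[OF B(1) b, of "\<lambda>b. u (w b)"] we by auto
    then show ?thesis using nonneg[of F e] e by (auto simp: val_ring_def)
  qed
  then show ?thesis using we by (intro exI[of _ "\<lambda>b. u (w b)"]) auto
qed

text \<open>More than three elements of \<open>V\<close> satisfy a relation; dividing it by a
  coefficient of least valuation makes all coefficients integral and one of them 1.\<close>

lemma relation:
  assumes T: "T \<subseteq> E" "3 < card T"
  obtains c e where "\<forall>t\<in>T. c t \<in> val_ring val" "e \<in> T" "c e \<notin> val_ideal val"
    "(\<Sum>t\<in>T. \<iota> (c t) * w t) = 0"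
proof -
  have fin: "finite T" using T finite_ground finite_subset by blast
  have inj: "inj_on w T" using inj_on_w T inj_on_subset by blast
  have wT: "w ` T \<subseteq> V" using w_in T by blast
  obtain u where u: "\<exists>t\<in>w ` T. u t \<noteq> 0" "(\<Sum>t\<in>w ` T. \<iota> (u t) * t) = 0"
    using vs.obtain_relation_if_dim_less_card[OF subspace, of "w ` T"] dim fin wT T card_image[OF inj] by auto
  have sum: "(\<Sum>t\<in>T. \<iota> (u (w t)) * w t) = 0" using u(2) inj by (simp add: sum.reindex)
  have "Min ((\<lambda>t. val (u (w t))) ` T) \<in> (\<lambda>t. val (u (w t))) ` T"
    using fin u(1) by (intro Min_in) auto
  then obtain i where i: "i \<in> T" "val (u (w i)) = Min ((\<lambda>t. val (u (w t))) ` T)" by auto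
  then have min: "val (u (w i)) \<le> val (u (w t))" if "t \<in> T" for t
    using fin that by simp
  have ui: "u (w i) \<noteq> 0"
  proof
    assume "u (w i) = 0"
    then have "val (u (w t)) = \<infinity>" if "t \<in> T" for t
      using min[OF that] valuation_zero[OF val] by simp
    then show False using u(1) valuation_eq_infinity_iff[OF val] by auto
  qed
  then obtain r where r: "val (u (w i)) = ereal r" using valuation_finite[OF val] by blast
  define c where "c = (\<lambda>t. inverse (u (w i)) * u (w t))"
  have valc: "val (c t) = val (u (w t)) - ereal r" for t
    using valuation_mult[OF val] valuation_inverse[OF val ui] r
    by (cases "val (u (w t))") (simp_all add: c_def)
  show ?thesis
  proof
    show "\<forall>t\<in>T. c t \<in> val_ring val"
    proof
      fix t assume "t \<in> T"
      then show "c t \<in> val_ring val"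
        using min[of t] r valc[of t] by (cases "val (u (w t))") (auto simp: val_ring_def)
    qed
    show "c i \<notin> val_ideal val"
      using valc[of i] r by (simp add: val_ideal_def)
    have "(\<Sum>t\<in>T. \<iota> (c t) * w t) = (\<Sum>t\<in>T. \<iota> (inverse (u (w i))) * (\<iota> (u (w t)) * w t))"
      unfolding c_def by (intro sum.cong) (simp_all add: vs.scale_scale)
    also have "\<dots> = 0" by (simp only: sum_distrib_left[symmetric] sum mult_zero_right)
    finally show "(\<Sum>t\<in>T. \<iota> (c t) * w t) = 0" .
  qed (rule i)
qed

text \<open>For three points of a line \<open>F\<close>, a relation with a fourth point off \<open>F\<close> has a coefficient of
  positive valuation at the fourth point, because \<open>\<mu> F\<close> is positive at the other three terms.\<close>

lemma dependent_relation:
  assumes S: "S \<subseteq> E" "\<not> indep S"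
  obtains c e where "\<forall>t\<in>S. c t \<in> val_ring val" "e \<in> S" "c e \<notin> val_ideal val"
    "\<forall>F\<in>lines. 0 < \<mu> F (\<Sum>t\<in>S. \<iota> (c t) * w t)"
proof (cases "3 < card S")
  case True
  then obtain c e where "\<forall>t\<in>S. c t \<in> val_ring val" "e \<in> S" "c e \<notin> val_ideal val"
    "(\<Sum>t\<in>S. \<iota> (c t) * w t) = 0"
    using relation[OF S(1)] by metis
  then show ?thesis using that valuation_zero[OF valuation] by simp
next
  case False
  have fin: "finite S" using S finite_ground finite_subset by blast
  \<comment> \<open>Sets of at most two points are independent, so \<open>S\<close> is a collinear
    triple.\<close>
  have "card S \<noteq> 0" using S fin indep_empty by auto
  moreover have "card S \<noteq> 1" using S indep_pair by (force simp: card_1_singleton_iff)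
  moreover have "card S \<noteq> 2" using S indep_pair by (auto simp: card_2_iff)
  ultimately have "card S = 3" using False by linarith
  then obtain x y z where xyz: "S = {x, y, z}" "x \<noteq> y" "x \<noteq> z" "y \<noteq> z"
    by (auto simp: card_3_iff)
  define F where "F = line x y"
  have F: "F \<in> lines" using xyz S line_in_lines by (simp add: F_def)
  have SF: "S \<subseteq> F" using xyz S by (auto simp: F_def line_def)
  obtain p where p: "p \<in> E" "p \<notin> F" using point_off_line[OF F] .
  then have pS: "p \<notin> S" using SF by blast
  obtain c e where c: "\<forall>t\<in>insert p S. c t \<in> val_ring val" "e \<in> insert p S" "c e \<notin> val_ideal val"
    "(\<Sum>t\<in>insert p S. \<iota> (c t) * w t) = 0"
    using relation[of "insert p S"] S p pS fin \<open>card S = 3\<close> by auto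
  then have eq: "(\<Sum>t\<in>S. \<iota> (c t) * w t) = - (\<iota> (c p) * w p)"
    using fin pS by (simp add: eq_neg_iff_add_eq_0 add.commute)
  have eqv: "\<mu> F' (\<Sum>t\<in>S. \<iota> (c t) * w t) = val (c p) + \<mu> F' (w p)" if "F' \<in> lines" for F'
    unfolding eq using valuation_uminus[OF valuation[OF that]] \<mu>_scale[OF that] by simp
  have "0 < \<mu> F (\<Sum>t\<in>S. \<iota> (c t) * w t)"
  proof (rule valuation_sum_gr[OF valuation[OF F] fin])
    fix t assume "t \<in> S"
    then show "0 < \<mu> F (\<iota> (c t) * w t)"
      using c(1) SF pos[OF F, of t] \<mu>_scale[OF F]
      by (auto simp: val_ring_def intro!: add_nonneg_pos)
  qed simp
  then have cp: "0 < val (c p)" using eqv[OF F] zero[OF F p] by simp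
  \<comment> \<open>The coefficient at \<open>p\<close> lies in the maximal ideal, so the unit
    coefficient belongs to a point of \<open>S\<close>. Positivity of \<open>val (c p)\<close> also
    makes the sum over \<open>S\<close> positive at every other line.\<close>
  then have "e \<noteq> p" using c(3) by (auto simp: val_ideal_def)
  then have "e \<in> S" using c(2) by blast
  moreover have "0 < \<mu> F' (\<Sum>t\<in>S. \<iota> (c t) * w t)" if "F' \<in> lines" for F'
    unfolding eqv[OF that] using cp nonneg[OF that p(1)] by (intro add_pos_nonneg)
  ultimately show ?thesis using that[of c e] c(1,3) by blast
qed

text \<open>A combination is positive at every line iff all its coordinates with respect to a basis
  \<open>B\<close> lie in \<open>val_ideal val\<close>: \<open>nonneg\<close> gives one direction,
  \<open>combination_le\<close> for \<open>B\<close> the other. Independence of \<open>S\<close> is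
  compared with this through \<open>combination_le\<close> for \<open>S\<close> and
  \<open>dependent_relation\<close>.\<close>

theorem realizable: "realizable_matroid E indep"
proof -
  obtain B where B: "indep B" "card B = 3"
    using mrank_attained[of E] mrank_ground by metis
  have BE: "B \<subseteq> E" and fin: "finite B" using B indep_ground finite_indep by auto
  \<comment> \<open>The coordinates of a vector configuration are indexed by numbers, so
    \<open>B\<close> is enumerated.\<close>
  obtain h :: "nat \<Rightarrow> 'a" where h: "bij_betw h {0..<3} B" using ex_bij_betw_nat_finite[OF fin] B(2) by auto
  have hB: "h ` {0..<3} = B" using h by (simp add: bij_betw_def)
  have "\<forall>e\<in>E. \<exists>x. w e = (\<Sum>b\<in>B. \<iota> (x b) * w b) \<and> (\<forall>b\<in>B. x b \<in> val_ring val)"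
    using combination_basis[OF B] by blast
  from bchoice[OF this] obtain x where x: "\<And>e. e \<in> E \<Longrightarrow> w e = (\<Sum>b\<in>B. \<iota> (x e b) * w b)"
    and xO: "\<And>e b. e \<in> E \<Longrightarrow> b \<in> B \<Longrightarrow> x e b \<in> val_ring val" by blast
  have sum: "(\<Sum>e\<in>S. \<iota> (c e) * w e) = (\<Sum>b\<in>B. \<iota> (\<Sum>e\<in>S. c e * x e b) * w b)" if "S \<subseteq> E" for S c
  proof -
    have "(\<Sum>e\<in>S. \<iota> (c e) * w e) = (\<Sum>e\<in>S. \<iota> (c e) * (\<Sum>b\<in>B. \<iota> (x e b) * w b))"
      using x that by (intro sum.cong) auto
    also have "\<dots> = (\<Sum>e\<in>S. \<Sum>b\<in>B. \<iota> (c e * x e b) * w b)"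
      by (simp add: sum_distrib_left vs.scale_scale)
    also have "\<dots> = (\<Sum>b\<in>B. \<Sum>e\<in>S. \<iota> (c e * x e b) * w b)"
      by (rule sum.swap)
    finally show ?thesis by (simp add: vs.scale_sum_left)
  qed
  have "indep S \<longleftrightarrow> lin_indep_family (residue_field val) 3 (\<lambda>e i. residue val (x e (h i))) S"
    if S: "S \<subseteq> E" for S
  proof -
    have finS: "finite S" using S finite_ground finite_subset by blast
    have "lin_indep_family (residue_field val) 3 (\<lambda>e i. residue val (x e (h i))) S \<longleftrightarrow>
      (\<forall>c. (\<forall>e\<in>S. c e \<in> val_ring val) \<longrightarrow> (\<forall>i<3. (\<Sum>e\<in>S. c e * x e (h i)) \<in> val_ideal val) \<longrightarrow>
        (\<forall>e\<in>S. c e \<in> val_ideal val))"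
      using S xO hB by (intro lin_indep_family_residue_iff[OF val finS]) auto
    also have "\<dots> \<longleftrightarrow>
      (\<forall>c. (\<forall>e\<in>S. c e \<in> val_ring val) \<longrightarrow> (\<forall>b\<in>B. (\<Sum>e\<in>S. c e * x e b) \<in> val_ideal val) \<longrightarrow>
        (\<forall>e\<in>S. c e \<in> val_ideal val))"
      unfolding hB[symmetric] by (auto simp: Ball_def)
    also have "\<dots> \<longleftrightarrow> indep S"
    proof
      assume iS: "indep S"
      show "\<forall>c. (\<forall>e\<in>S. c e \<in> val_ring val) \<longrightarrow> (\<forall>b\<in>B. (\<Sum>e\<in>S. c e * x e b) \<in> val_ideal val) \<longrightarrow>
        (\<forall>e\<in>S. c e \<in> val_ideal val)"
      proof (intro allI impI ballI)
        fix c j assume c: "\<forall>b\<in>B. (\<Sum>e\<in>S. c e * x e b) \<in> val_ideal val" and j: "j \<in> S"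
        obtain F where F: "F \<in> lines" "\<mu> F (\<Sum>e\<in>S. \<iota> (c e) * w e) \<le> val (c j)"
          using combination_le[OF iS j] by blast
        \<comment> \<open>Coordinates in the maximal ideal make the sum positive at every line; at
          this \<open>F\<close> its valuation is a lower bound for \<open>val (c j)\<close>.\<close>
        have "0 < \<mu> F (\<Sum>b\<in>B. \<iota> (\<Sum>e\<in>S. c e * x e b) * w b)"
        proof (rule valuation_sum_gr[OF valuation[OF F(1)] fin])
          fix b assume "b \<in> B"
          then show "0 < \<mu> F (\<iota> (\<Sum>e\<in>S. c e * x e b) * w b)"
            unfolding \<mu>_scale[OF F(1)] using c nonneg[OF F(1), of b] BE
            by (intro add_pos_nonneg) (auto simp: val_ideal_def)
        qed simp
        then show "c j \<in> val_ideal val" using F(2) sum[OF S] by (simp add: val_ideal_def)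
      qed
    next
      assume R: "\<forall>c. (\<forall>e\<in>S. c e \<in> val_ring val) \<longrightarrow> (\<forall>b\<in>B. (\<Sum>e\<in>S. c e * x e b) \<in> val_ideal val) \<longrightarrow>
        (\<forall>e\<in>S. c e \<in> val_ideal val)"
      show "indep S"
      proof (rule ccontr)
        assume "\<not> indep S"
        then obtain c e where c: "\<forall>t\<in>S. c t \<in> val_ring val" "e \<in> S" "c e \<notin> val_ideal val"
          "\<forall>F\<in>lines. 0 < \<mu> F (\<Sum>t\<in>S. \<iota> (c t) * w t)"
          by (rule dependent_relation[OF S])
        have "(\<Sum>e\<in>S. c e * x e b) \<in> val_ideal val" if b: "b \<in> B" for b
        proof -
          obtain F where F: "F \<in> lines"
            "\<mu> F (\<Sum>b\<in>B. \<iota> (\<Sum>e\<in>S. c e * x e b) * w b) \<le> val (\<Sum>e\<in>S. c e * x e b)"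
            using combination_le[OF B(1) b, of "\<lambda>b. \<Sum>e\<in>S. c e * x e b"] by blast
          have "0 < \<mu> F (\<Sum>b\<in>B. \<iota> (\<Sum>e\<in>S. c e * x e b) * w b)"
            using c(4) F(1) sum[OF S, of c] by simp
          then show ?thesis using F(2) by (simp add: val_ideal_def)
        qed
        then show False using R c by blast
      qed
    qed
    finally show ?thesis by simp
  qed
  moreover have "residue val (x e (h i)) \<in> carrier (residue_field val)" if "e \<in> E" "i < 3" for e i
    using xO[of e "h i"] hB that by (auto simp: carrier_residue_field[OF val])
  ultimately have "realizable_over (residue_field val) E indep"
    unfolding realizable_over_def
    by (intro conjI exI[of _ 3] exI[of _ "\<lambda>e i. residue val (x e (h i))"] field_residue_field[OF val])
      simp_all
  then show ?thesis by (rule realizable_over_any_field[OF finite_ground])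
qed

end

section \<open>A minimum principle for piecewise linear functions\<close>

lemma pl_on_interval_right_germ:
  assumes "pl_on_interval l g" "0 \<le> s" "s < l"
  obtains \<delta> and m :: int where "0 < \<delta>" "s + \<delta> \<le> l" "\<forall>h\<in>{0..\<delta>}. g (s + h) = g s + of_int m * h"
proof -
  obtain B where B: "finite B" "\<And>s t. 0 \<le> s \<Longrightarrow> s < t \<Longrightarrow> t \<le> l \<Longrightarrow> B \<inter> {s<..<t} = {} \<Longrightarrow>
      \<exists>m::int. \<forall>u\<in>{s..t}. g u = g s + of_int m * (u - s)"
    using assms(1) unfolding pl_on_interval_def by blast
  \<comment> \<open>Only the open interval has to avoid \<open>B\<close>, so \<open>s\<close> itself
    may be a breakpoint; \<open>d\<close> keeps away from the others.\<close>
  obtain d where d: "0 < d" "\<forall>x\<in>B. x \<noteq> s \<longrightarrow> d \<le> dist s x"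
    using finite_set_avoid[OF B(1), of s] by blast
  define \<delta> where "\<delta> = min d (l - s)"
  have \<delta>: "0 < \<delta>" "s + \<delta> \<le> l" "\<delta> \<le> d" using d assms by (auto simp: \<delta>_def)
  have "B \<inter> {s<..<s + \<delta>} = {}"
    using d(2) \<delta> by (force simp: dist_real_def)
  then obtain m :: int where m: "\<forall>u\<in>{s..s + \<delta>}. g u = g s + of_int m * (u - s)"
    using B(2)[of s "s + \<delta>"] \<delta> assms(2) by auto
  have "\<forall>h\<in>{0..\<delta>}. g (s + h) = g s + of_int m * h"
  proof
    fix h assume "h \<in> {0..\<delta>}"
    then show "g (s + h) = g s + of_int m * h" using m[rule_format, of "s + h"] by simp
  qed
  then show ?thesis using that[of \<delta> m] \<delta> by blast
qed

text \<open>Reversing the edge turns left germs into right germs.\<close>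

lemma pl_on_interval_reflect:
  assumes "pl_on_interval l g" shows "pl_on_interval l (\<lambda>s. g (l - s))"
proof -
  obtain B where B: "finite B" "\<And>s t. 0 \<le> s \<Longrightarrow> s < t \<Longrightarrow> t \<le> l \<Longrightarrow> B \<inter> {s<..<t} = {} \<Longrightarrow>
      \<exists>m::int. \<forall>u\<in>{s..t}. g u = g s + of_int m * (u - s)"
    using assms unfolding pl_on_interval_def by blast
  have "\<exists>m::int. \<forall>u\<in>{s..t}. g (l - u) = g (l - s) + of_int m * (u - s)"
    if st: "0 \<le> s" "s < t" "t \<le> l" "(\<lambda>x. l - x) ` B \<inter> {s<..<t} = {}" for s t
  proof -
    have "B \<inter> {l - t<..<l - s} = {}"
    proof -
      have "l - x \<notin> {s<..<t}" if "x \<in> B" for x using st(4) that by blast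
      then show ?thesis by force
    qed
    then obtain m :: int where m: "\<forall>u\<in>{l - t..l - s}. g u = g (l - t) + of_int m * (u - (l - t))"
      using B(2)[of "l - t" "l - s"] st by auto
    have "g (l - u) = g (l - s) + of_int (- m) * (u - s)" if "u \<in> {s..t}" for u
      using m[rule_format, of "l - u"] m[rule_format, of "l - s"] that st by (simp add: algebra_simps)
    then show ?thesis by blast
  qed
  then show ?thesis
    unfolding pl_on_interval_def using B(1) by (intro exI[of _ "(\<lambda>x. l - x) ` B"]) auto
qed

lemma pl_on_interval_left_germ:
  assumes "pl_on_interval l g" "0 < s" "s \<le> l"
  obtains \<delta> and m :: int where "0 < \<delta>" "0 \<le> s - \<delta>" "\<forall>h\<in>{0..\<delta>}. g (s - h) = g s + of_int m * h"
proof -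
  have le: "0 \<le> l - s" "l - s < l" using assms by auto
  obtain \<delta> and m :: int where "0 < \<delta>" "l - s + \<delta> \<le> l"
    "\<forall>h\<in>{0..\<delta>}. g (l - (l - s + h)) = g (l - (l - s)) + of_int m * h"
    using pl_on_interval_right_germ[OF pl_on_interval_reflect[OF assms(1)] le] by blast
  then show ?thesis using that[of \<delta> m] by simp
qed

text \<open>This also justifies the definite description in \<open>out_slope\<close>: two slopes of
  the same germ agree because they give the same values at a small nonzero \<open>h\<close>.\<close>

lemma PL_germ:
  assumes "\<phi> \<in> PL G" and d: "(e, s, \<sigma>) \<in> directions G p"
  obtains \<delta> where "0 < \<delta>"
    "\<And>h. 0 \<le> h \<Longrightarrow> h \<le> \<delta> \<Longrightarrow> s + \<sigma> * h \<in> {0..len G e} \<and>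
      \<phi> (edge_pt G e (s + \<sigma> * h)) = \<phi> p + of_int (out_slope G \<phi> (e, s, \<sigma>)) * h"
proof -
  let ?g = "\<lambda>s. \<phi> (edge_pt G e s)"
  have e: "e \<in> edges G" "s \<in> {0..len G e}" "edge_pt G e s = p"
    and \<sigma>: "\<sigma> = 1 \<and> s < len G e \<or> \<sigma> = - 1 \<and> 0 < s"
    using d by (auto simp: directions_def)
  have s: "0 \<le> s" "s \<le> len G e" using e(2) by auto
  have pl: "pl_on_interval (len G e) ?g" using assms(1) e by (simp add: PL_def)
  have "\<exists>\<delta> m::int. 0 < \<delta> \<and> (\<forall>h. 0 \<le> h \<longrightarrow> h \<le> \<delta> \<longrightarrow> s + \<sigma> * h \<in> {0..len G e} \<and>
      ?g (s + \<sigma> * h) = ?g s + of_int m * h)"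
    using \<sigma>
  proof
    assume *: "\<sigma> = 1 \<and> s < len G e"
    then obtain \<delta> and m :: int where "0 < \<delta>" "s + \<delta> \<le> len G e" "\<forall>h\<in>{0..\<delta>}. ?g (s + h) = ?g s + of_int m * h"
      using pl_on_interval_right_germ[OF pl, of s] s by blast
    then show ?thesis using * e(2) by (intro exI[of _ \<delta>] exI[of _ m]) auto
  next
    assume *: "\<sigma> = - 1 \<and> 0 < s"
    then obtain \<delta> and m :: int where "0 < \<delta>" "0 \<le> s - \<delta>" "\<forall>h\<in>{0..\<delta>}. ?g (s - h) = ?g s + of_int m * h"
      using pl_on_interval_left_germ[OF pl, of s] s by blast
    then show ?thesis using * e(2) by (intro exI[of _ \<delta>] exI[of _ m]) auto
  qed
  then obtain \<delta> and m :: int where \<delta>: "0 < \<delta>"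
    and m: "\<And>h. 0 \<le> h \<Longrightarrow> h \<le> \<delta> \<Longrightarrow> s + \<sigma> * h \<in> {0..len G e} \<and> ?g (s + \<sigma> * h) = ?g s + of_int m * h"
    by blast
  have ev: "\<forall>\<^sub>F h in at_right 0. 0 \<le> h \<and> h \<le> \<delta> \<and> h \<noteq> 0"
    using \<delta> unfolding eventually_at_right_field by (intro exI[of _ \<delta>]) auto
  have "out_slope G \<phi> (e, s, \<sigma>) = m"
    unfolding out_slope_def prod.case
  proof (rule the_equality)
    show "\<forall>\<^sub>F h in at_right 0. ?g (s + \<sigma> * h) = ?g s + of_int m * h"
      using ev by eventually_elim (use m in auto)
    fix n :: int assume "\<forall>\<^sub>F h in at_right 0. ?g (s + \<sigma> * h) = ?g s + of_int n * h"
    with ev have "\<forall>\<^sub>F h in at_right (0::real). n = m"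
    proof eventually_elim
      case (elim h)
      then have "of_int n * h = of_int m * h" using m[of h] by auto
      then show ?case using elim by simp
    qed
    then show "n = m" by simp
  qed
  then show ?thesis using that[of \<delta>] \<delta> m e(3) by auto
qed

lemma finite_directions:
  assumes "wf_mgraph G" shows "finite (directions G p)"
proof (rule finite_subset)
  \<comment> \<open>A point sits on an edge at an end or at its own parameter; for a vertex the
    \<open>case\<close> returns 0, which is already listed.\<close>
  show "directions G p \<subseteq> edges G \<times> ((\<Union>e\<in>edges G. {0, len G e, case p of Inner _ s \<Rightarrow> s | Vertex _ \<Rightarrow> 0}) \<times> {1, - 1})"
    by (auto simp: directions_def edge_pt_def split: if_splits)
  show "finite (edges G \<times> ((\<Union>e\<in>edges G. {0, len G e, case p of Inner _ s \<Rightarrow> s | Vertex _ \<Rightarrow> 0}) \<times> {1, - 1::real}))"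
    using assms by (auto simp: wf_mgraph_def)
qed

lemma out_slope_nonneg:
  assumes "\<phi> \<in> PL G" and d: "(e, s, \<sigma>) \<in> directions G p"
    and min: "\<And>u. u \<in> {0..len G e} \<Longrightarrow> \<phi> p \<le> \<phi> (edge_pt G e u)"
  shows "0 \<le> out_slope G \<phi> (e, s, \<sigma>)"
proof -
  obtain \<delta> where "0 < \<delta>" "s + \<sigma> * \<delta> \<in> {0..len G e} \<and>
      \<phi> (edge_pt G e (s + \<sigma> * \<delta>)) = \<phi> p + of_int (out_slope G \<phi> (e, s, \<sigma>)) * \<delta>"
    using PL_germ[OF assms(1) d] by (metis less_imp_le order_refl)
  then have "0 \<le> real_of_int (out_slope G \<phi> (e, s, \<sigma>)) * \<delta>" using min by fastforce
  then show ?thesis using \<open>0 < \<delta>\<close> by (simp add: zero_le_mult_iff)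
qed

text \<open>At such a minimum all outgoing slopes are nonnegative, while
  \<open>0 \<le> pl_div G \<phi> p\<close> says that their sum is at most 0.\<close>

lemma out_slope_zero_if_min:
  assumes "wf_mgraph G" and "\<phi> \<in> PL G" and "0 \<le> pl_div G \<phi> p"
    and min: "\<And>e s \<sigma> u. (e, s, \<sigma>) \<in> directions G p \<Longrightarrow> u \<in> {0..len G e} \<Longrightarrow> \<phi> p \<le> \<phi> (edge_pt G e u)"
    and d: "d \<in> directions G p"
  shows "out_slope G \<phi> d = 0"
proof -
  have nn: "0 \<le> out_slope G \<phi> d'" if "d' \<in> directions G p" for d'
    using out_slope_nonneg[OF assms(2)] min that by (metis prod_cases3)
  moreover have "(\<Sum>d\<in>directions G p. out_slope G \<phi> d) = 0"
    using assms(3) sum_nonneg[of "directions G p" "out_slope G \<phi>"] nn by (simp add: pl_div_def)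
  ultimately show ?thesis
    using sum_nonneg_eq_0_iff[OF finite_directions[OF assms(1)], of p "out_slope G \<phi>"] d by blast
qed

section \<open>Continuity and the spread of minima along an edge\<close>

lemma pl_on_interval_continuous:
  assumes "pl_on_interval l g" shows "continuous_on {0..l} g"
proof -
  have "\<exists>\<delta>>0. \<forall>y\<in>{0..l}. dist y x < \<delta> \<longrightarrow> dist (g y) (g x) < \<epsilon>" if x: "x \<in> {0..l}" and \<epsilon>: "0 < \<epsilon>" for x \<epsilon>
  proof -
    have x': "0 \<le> x" "x \<le> l" using x by auto
    \<comment> \<open>A germ is Lipschitz on its side of \<open>x\<close>; at an end of the interval
      the missing side contains only \<open>x\<close> itself.\<close>
    have "\<exists>\<delta> k. 0 < \<delta> \<and> (\<forall>y\<in>{x..l}. dist y x < \<delta> \<longrightarrow> dist (g y) (g x) \<le> k * dist y x)"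
    proof (cases "x < l")
      case True
      then obtain \<delta> and m :: int where \<delta>: "0 < \<delta>" "\<forall>h\<in>{0..\<delta>}. g (x + h) = g x + of_int m * h"
        using pl_on_interval_right_germ[OF assms, of x] x' by blast
      have "dist (g y) (g x) \<le> \<bar>of_int m\<bar> * dist y x" if y: "y \<in> {x..l}" "dist y x < \<delta>" for y
      proof -
        have "y - x \<in> {0..\<delta>}" using y by (simp add: dist_real_def)
        with \<delta>(2) have "g (x + (y - x)) = g x + of_int m * (y - x)" by blast
        then show ?thesis by (simp add: dist_real_def abs_mult abs_minus_commute)
      qed
      then show ?thesis using \<delta>(1) by blast
    next
      case False
      have "dist (g y) (g x) \<le> 1 * dist y x" if "y \<in> {x..l}" for y
      proof -
        have "y = x" using that False x by auto
        then show ?thesis by simp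
      qed
      then show ?thesis by (intro exI[of _ 1]) auto
    qed
    then obtain \<delta>1 k1 where 1: "0 < \<delta>1" "\<forall>y\<in>{x..l}. dist y x < \<delta>1 \<longrightarrow> dist (g y) (g x) \<le> k1 * dist y x"
      by blast
    have "\<exists>\<delta> k. 0 < \<delta> \<and> (\<forall>y\<in>{0..x}. dist y x < \<delta> \<longrightarrow> dist (g y) (g x) \<le> k * dist y x)"
    proof (cases "0 < x")
      case True
      then obtain \<delta> and m :: int where \<delta>: "0 < \<delta>" "\<forall>h\<in>{0..\<delta>}. g (x - h) = g x + of_int m * h"
        using pl_on_interval_left_germ[OF assms, of x] x' by blast
      have "dist (g y) (g x) \<le> \<bar>of_int m\<bar> * dist y x" if y: "y \<in> {0..x}" "dist y x < \<delta>" for y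
      proof -
        have "x - y \<in> {0..\<delta>}" using y by (simp add: dist_real_def)
        with \<delta>(2) have "g (x - (x - y)) = g x + of_int m * (x - y)" by blast
        then show ?thesis by (simp add: dist_real_def abs_mult abs_minus_commute)
      qed
      then show ?thesis using \<delta>(1) by blast
    next
      case False
      have "dist (g y) (g x) \<le> 1 * dist y x" if "y \<in> {0..x}" for y
      proof -
        have "y = x" using that False x by auto
        then show ?thesis by simp
      qed
      then show ?thesis by (intro exI[of _ 1]) auto
    qed
    then obtain \<delta>2 k2 where 2: "0 < \<delta>2" "\<forall>y\<in>{0..x}. dist y x < \<delta>2 \<longrightarrow> dist (g y) (g x) \<le> k2 * dist y x"
      by blast
    \<comment> \<open>The maximum with 1 keeps \<open>k\<close> positive, so that
      \<open>\<epsilon>\<close> can be divided by it.\<close>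
    define k where "k = max 1 (max k1 k2)"
    have k: "k1 \<le> k" "k2 \<le> k" "0 < k" by (auto simp: k_def)
    define \<delta> where "\<delta> = min (\<epsilon> / k) (min \<delta>1 \<delta>2)"
    have "dist (g y) (g x) < \<epsilon>" if y: "y \<in> {0..l}" "dist y x < \<delta>" for y
    proof -
      have "dist (g y) (g x) \<le> k1 * dist y x \<or> dist (g y) (g x) \<le> k2 * dist y x"
        using 1(2) 2(2) y by (cases "y \<le> x") (auto simp: \<delta>_def)
      moreover have "k1 * dist y x \<le> k * dist y x" "k2 * dist y x \<le> k * dist y x"
        using k by (auto intro: mult_right_mono)
      moreover have "k * dist y x < \<epsilon>" using y(2) k by (simp add: \<delta>_def field_simps)
      ultimately show ?thesis by linarith
    qed
    moreover have "0 < \<delta>" using 1 2 k \<epsilon> by (simp add: \<delta>_def)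
    ultimately show ?thesis by blast
  qed
  then show ?thesis unfolding continuous_on_iff by blast
qed

text \<open>The set where \<open>\<phi>\<close> attains its minimum is open and closed in an edge
  on whose interior \<open>div \<phi>\<close> is effective.\<close>

lemma constant_if_inner_min:
  assumes G: "wf_mgraph G" and \<phi>: "\<phi> \<in> PL G" and e: "e \<in> edges G"
    and super: "\<And>s. 0 < s \<Longrightarrow> s < len G e \<Longrightarrow> 0 \<le> pl_div G \<phi> (Inner e s)"
    and min: "\<And>u. u \<in> {0..len G e} \<Longrightarrow> c \<le> \<phi> (edge_pt G e u)"
    and s: "0 < s" "s < len G e" "\<phi> (edge_pt G e s) = c"
    and u: "u \<in> {0..len G e}"
  shows "\<phi> (edge_pt G e u) = c"
proof -
  let ?l = "len G e" and ?g = "\<lambda>s. \<phi> (edge_pt G e s)"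
  define A where "A = {x \<in> {0<..<?l}. ?g x = c}"
  have cont: "continuous_on {0..?l} ?g"
    using \<phi> e by (intro pl_on_interval_continuous) (simp add: PL_def)
  have nbhd: "\<exists>\<delta>>0. \<forall>y. dist y x < \<delta> \<longrightarrow> y \<in> A" if x: "x \<in> A" for x
  proof -
    have pt: "edge_pt G e x = Inner e x" using x by (simp add: A_def edge_pt_def)
    have dirs: "(e, x, 1) \<in> directions G (Inner e x)" "(e, x, - 1) \<in> directions G (Inner e x)"
      using x e pt by (auto simp: directions_def A_def)
    \<comment> \<open>All directions at an inner point run along \<open>e\<close>, so minimality on
      this edge alone makes the slopes vanish.\<close>
    have "e' = e" if "(e', s', \<sigma>) \<in> directions G (Inner e x)" for e' s' \<sigma>
      using that by (auto simp: directions_def edge_pt_def split: if_splits)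
    then have zero: "out_slope G \<phi> d = 0" if "d \<in> directions G (Inner e x)" for d
      using out_slope_zero_if_min[OF G \<phi> super _ that] min x pt by (force simp: A_def)
    obtain \<delta>1 where 1: "0 < \<delta>1" "\<And>h. 0 \<le> h \<Longrightarrow> h \<le> \<delta>1 \<Longrightarrow> ?g (x + 1 * h) = \<phi> (Inner e x) + of_int (out_slope G \<phi> (e, x, 1)) * h"
      using PL_germ[OF \<phi> dirs(1)] by metis
    obtain \<delta>2 where 2: "0 < \<delta>2" "\<And>h. 0 \<le> h \<Longrightarrow> h \<le> \<delta>2 \<Longrightarrow> ?g (x + - 1 * h) = \<phi> (Inner e x) + of_int (out_slope G \<phi> (e, x, - 1)) * h"
      using PL_germ[OF \<phi> dirs(2)] by metis
    define \<delta> where "\<delta> = Min {\<delta>1, \<delta>2, x, ?l - x}"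
    have \<delta>: "0 < \<delta>" "\<delta> \<le> \<delta>1" "\<delta> \<le> \<delta>2" "\<delta> \<le> x" "\<delta> \<le> ?l - x"
      using 1(1) 2(1) x by (auto simp: \<delta>_def A_def)
    have "y \<in> A" if "dist y x < \<delta>" for y
    proof -
      have "?g y = c"
        using 1(2)[of "y - x"] 2(2)[of "x - y"] that \<delta> zero[OF dirs(1)] zero[OF dirs(2)] x pt
        by (cases "x \<le> y") (auto simp: dist_real_def A_def)
      then show ?thesis using that \<delta> by (auto simp: A_def dist_real_def)
    qed
    then show ?thesis using \<delta>(1) by blast
  qed
  then have "open A" unfolding open_dist by blast
  moreover have "open ({0<..<?l} - A)"
  proof -
    have "continuous_on {0<..<?l} ?g" by (rule continuous_on_subset[OF cont]) auto
    then have "open ({0<..<?l} \<inter> ?g -` (- {c}))"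
      by (rule continuous_open_preimage) auto
    moreover have "{0<..<?l} - A = {0<..<?l} \<inter> ?g -` (- {c})" by (auto simp: A_def)
    ultimately show ?thesis by simp
  qed
  moreover have "s \<in> A" using s by (simp add: A_def)
  ultimately have A: "A = {0<..<?l}"
    using connectedD[OF connected_Ioo[of 0 ?l], of A "{0<..<?l} - A"] by (auto simp: A_def)
  have "closure {0<..<?l} = {0..?l}" using s by simp
  moreover have "\<forall>x\<in>{0<..<?l}. ?g x = c" using A by (auto simp: A_def)
  ultimately show ?thesis
    using continuous_constant_on_closure[of "{0<..<?l}" ?g c u] cont u by auto
qed

text \<open>On the compact edge a minimum is attained; if this happens inside, the function is
  constant, so an end attains it as well.\<close>

lemma min_at_endpoint:
  assumes G: "wf_mgraph G" and \<phi>: "\<phi> \<in> PL G" and e: "e \<in> edges G"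
    and super: "\<And>s. 0 < s \<Longrightarrow> s < len G e \<Longrightarrow> 0 \<le> pl_div G \<phi> (Inner e s)"
    and c: "c \<le> \<phi> (edge_pt G e 0)" "c \<le> \<phi> (edge_pt G e (len G e))"
    and u: "u \<in> {0..len G e}"
  shows "c \<le> \<phi> (edge_pt G e u)"
proof -
  let ?l = "len G e" and ?g = "\<lambda>s. \<phi> (edge_pt G e s)"
  have cont: "continuous_on {0..?l} ?g"
    using \<phi> e by (intro pl_on_interval_continuous) (simp add: PL_def)
  obtain x where x: "x \<in> {0..?l}" "\<forall>y\<in>{0..?l}. ?g x \<le> ?g y"
    using continuous_attains_inf[OF compact_Icc _ cont] u by auto
  have "c \<le> ?g x"
  proof (cases "0 < x \<and> x < ?l")
    case True
    have "?g 0 = ?g x"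
    proof (rule constant_if_inner_min[OF G \<phi> e super])
      show "?g x \<le> ?g v" if "v \<in> {0..?l}" for v using x(2) that by blast
      show "0 < x" "x < ?l" "0 \<in> {0..?l}" using True by auto
    qed auto
    then show ?thesis using c by simp
  next
    case False
    then have "x = 0 \<or> x = ?l" using x by auto
    then show ?thesis using c by auto
  qed
  then show ?thesis using x u by force
qed

section \<open>Functions on the Levi graph\<close>

locale levi = simple_rank3_matroid +
  fixes elen :: "'a \<times> 'a set \<Rightarrow> real"
  assumes elen_pos: "F \<in> lines \<Longrightarrow> e \<in> F \<Longrightarrow> 0 < elen (e, F)"
begin

abbreviation G :: "('a + 'a set, 'a \<times> 'a set) mgraph" where
  "G \<equiv> levi_graph E indep elen"

abbreviation D :: "('a + 'a set, 'a \<times> 'a set) mpoint \<Rightarrow> int" where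
  "D \<equiv> cartwright_divisor E"

abbreviation pt :: "'a \<Rightarrow> ('a + 'a set, 'a \<times> 'a set) mpoint" where
  "pt e \<equiv> Vertex (Inl e)"

abbreviation ln :: "'a set \<Rightarrow> ('a + 'a set, 'a \<times> 'a set) mpoint" where
  "ln F \<equiv> Vertex (Inr F)"

lemma wf_G: "wf_mgraph G"
proof -
  have "edges G \<subseteq> E \<times> lines" using lines_subset by (auto simp: levi_graph_def)
  then have "finite (edges G)" using finite_ground finite_lines by (meson finite_SigmaI finite_subset)
  then show ?thesis
    using finite_ground finite_lines lines_subset elen_pos by (auto simp: wf_mgraph_def levi_graph_def)
qed

lemma edges_iff: "(e, F) \<in> edges G \<longleftrightarrow> F \<in> lines \<and> e \<in> F"
  by (auto simp: levi_graph_def)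

lemma len_G: "len G (e, F) = elen (e, F)"
  by (simp add: levi_graph_def)

lemma edge_pt_tail: "edge_pt G (e, F) 0 = pt e"
  by (simp add: edge_pt_def levi_graph_def)

lemma edge_pt_head: "F \<in> lines \<Longrightarrow> e \<in> F \<Longrightarrow> edge_pt G (e, F) (elen (e, F)) = ln F"
  using elen_pos[of F e] by (auto simp: edge_pt_def levi_graph_def)

lemma pt_in_points: "e \<in> E \<Longrightarrow> pt e \<in> points G"
  and ln_in_points: "F \<in> lines \<Longrightarrow> ln F \<in> points G"
  by (auto simp: points_def levi_graph_def)

lemma direction_at_pt: "F \<in> lines \<Longrightarrow> e \<in> F \<Longrightarrow> ((e, F), 0, 1) \<in> directions G (pt e)"
  using elen_pos[of F e] by (simp add: directions_def edges_iff edge_pt_tail len_G)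

lemma direction_at_ln: "F \<in> lines \<Longrightarrow> e \<in> F \<Longrightarrow> ((e, F), elen (e, F), - 1) \<in> directions G (ln F)"
  using elen_pos[of F e] by (simp add: directions_def edges_iff edge_pt_head len_G)

section \<open>The locus where a function in \<open>RD G D\<close> is minimal\<close>

context
  fixes \<phi> c
  assumes \<phi>: "\<phi> \<in> RD G D"
    and c_pt: "\<forall>e\<in>E. c \<le> \<phi> (pt e)"
    and c_ln: "\<forall>F\<in>lines. c \<le> \<phi> (ln F)"
begin

lemma \<phi>_PL: "\<phi> \<in> PL G"
  using \<phi> by (simp add: RD_def)

lemma div_inner: "ed \<in> edges G \<Longrightarrow> 0 < s \<Longrightarrow> s < len G ed \<Longrightarrow> 0 \<le> pl_div G \<phi> (Inner ed s)"
proof -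
  assume "ed \<in> edges G" "0 < s" "s < len G ed"
  then have "Inner ed s \<in> points G" by (cases ed) (auto simp: points_def)
  then have "0 \<le> D (Inner ed s) + pl_div G \<phi> (Inner ed s)" using \<phi> by (simp add: RD_def)
  then show ?thesis by (auto simp: cartwright_divisor_def split: if_splits)
qed

text \<open>All chips of \<open>D\<close> lie on vertices, so a lower bound at the two ends of an
  edge holds along it.\<close>

lemma c_edge:
  assumes "ed \<in> edges G" "u \<in> {0..len G ed}" shows "c \<le> \<phi> (edge_pt G ed u)"
proof -
  obtain e F where ed: "ed = (e, F)" by (cases ed)
  have F: "F \<in> lines" "e \<in> F" using assms(1) ed by (auto simp: edges_iff)
  show ?thesis
  proof (rule min_at_endpoint[OF wf_G \<phi>_PL assms(1) div_inner[OF assms(1)] _ _ assms(2)])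
    show "c \<le> \<phi> (edge_pt G ed 0)" using c_pt lines_subset F by (auto simp: ed edge_pt_tail)
    show "c \<le> \<phi> (edge_pt G ed (len G ed))" using c_ln F by (simp add: ed len_G edge_pt_head)
  qed
qed

lemma slope_nonneg:
  assumes "d \<in> directions G p" "\<phi> p = c" shows "0 \<le> out_slope G \<phi> d"
proof -
  obtain ed s \<sigma> where d: "d = (ed, s, \<sigma>)" by (cases d)
  then have "ed \<in> edges G" using assms(1) by (simp add: directions_def)
  then show ?thesis
    using out_slope_nonneg[OF \<phi>_PL assms(1)[unfolded d]] c_edge assms(2) by (simp add: d)
qed

text \<open>A zero slope yields an inner point with value \<open>c\<close>, from which the minimum
  spreads over the edge.\<close>

lemma constant_on_edge:
  assumes d: "(ed, s, \<sigma>) \<in> directions G p" and p: "\<phi> p = c" and z: "out_slope G \<phi> (ed, s, \<sigma>) = 0"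
    and u: "u \<in> {0..len G ed}"
  shows "\<phi> (edge_pt G ed u) = c"
proof -
  have ed: "ed \<in> edges G" and s: "0 \<le> s" "s \<le> len G ed"
    and \<sigma>: "\<sigma> = 1 \<and> s < len G ed \<or> \<sigma> = - 1 \<and> 0 < s"
    using d by (auto simp: directions_def)
  obtain \<delta> where \<delta>: "0 < \<delta>" "\<And>h. 0 \<le> h \<Longrightarrow> h \<le> \<delta> \<Longrightarrow> s + \<sigma> * h \<in> {0..len G ed} \<and>
      \<phi> (edge_pt G ed (s + \<sigma> * h)) = \<phi> p + of_int (out_slope G \<phi> (ed, s, \<sigma>)) * h"
    using PL_germ[OF \<phi>_PL d] by blast
  \<comment> \<open>Half the distance to the end ahead, so that the new point stays inside the
    edge.\<close>
  define k where "k = (if \<sigma> = 1 then (len G ed - s) / 2 else s / 2)"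
  define h where "h = min \<delta> k"
  have h: "0 < h" "h \<le> \<delta>" "0 < s + \<sigma> * h" "s + \<sigma> * h < len G ed"
  proof -
    have "0 < k" using \<sigma> by (auto simp: k_def)
    then show "0 < h" "h \<le> \<delta>" using \<delta>(1) by (simp_all add: h_def)
    moreover have "h \<le> k" by (simp add: h_def)
    moreover have "\<sigma> = 1 \<Longrightarrow> k = (len G ed - s) / 2" "\<sigma> = - 1 \<Longrightarrow> k = s / 2"
      by (simp_all add: k_def)
    ultimately show "0 < s + \<sigma> * h" "s + \<sigma> * h < len G ed"
      using \<sigma> s by auto
  qed
  have "\<phi> (edge_pt G ed (s + \<sigma> * h)) = c" using \<delta>(2)[of h] h p z by simp
  from constant_if_inner_min[OF wf_G \<phi>_PL ed _ _ h(3,4) this u] show ?thesis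
    using div_inner[OF ed] c_edge[OF ed] by blast
qed

text \<open>There is no chip at a line, so all slopes vanish there and the minimum spreads along
  every edge to the points of the line.\<close>

lemma pt_min_if_ln_min:
  assumes F: "F \<in> lines" "e \<in> F" and "\<phi> (ln F) = c"
  shows "\<phi> (pt e) = c"
proof -
  have "0 \<le> pl_div G \<phi> (ln F)"
  proof -
    have "0 \<le> D (ln F) + pl_div G \<phi> (ln F)" using \<phi> ln_in_points[OF F(1)] by (simp add: RD_def)
    then show ?thesis by (auto simp: cartwright_divisor_def split: if_splits)
  qed
  moreover have "\<phi> (ln F) \<le> \<phi> (edge_pt G ed u)"
    if "(ed, s, \<sigma>) \<in> directions G (ln F)" "u \<in> {0..len G ed}" for ed s \<sigma> u
    using c_edge[of ed u] that assms(3) by (simp add: directions_def)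
  ultimately have "out_slope G \<phi> ((e, F), elen (e, F), - 1) = 0"
    using out_slope_zero_if_min[OF wf_G \<phi>_PL _ _ direction_at_ln[OF F]] by blast
  then have "\<phi> (edge_pt G (e, F) 0) = c"
    using constant_on_edge[OF direction_at_ln[OF F] assms(3)] elen_pos[OF F] by (simp add: len_G)
  then show ?thesis by (simp add: edge_pt_tail)
qed

lemma ln_min_if_slope_zero:
  assumes F: "F \<in> lines" "e \<in> F" and "\<phi> (pt e) = c" "out_slope G \<phi> ((e, F), 0, 1) = 0"
  shows "\<phi> (ln F) = c"
proof -
  have "\<phi> (edge_pt G (e, F) (elen (e, F))) = c"
    using constant_on_edge[OF direction_at_pt[OF F] assms(3,4)] elen_pos[OF F] by (simp add: len_G)
  then show ?thesis using edge_pt_head[OF F] by simp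
qed

text \<open>The single chip at \<open>e\<close> allows a total outgoing slope of at most 1. The
  slopes are nonnegative integers, so two of them cannot both be positive.\<close>

lemma ln_min_if_pt_min:
  assumes F: "F \<in> lines" "e \<in> F" and F': "F' \<in> lines" "e \<in> F'" "F \<noteq> F'" and e: "\<phi> (pt e) = c"
  shows "\<phi> (ln F) = c \<or> \<phi> (ln F') = c"
proof (rule ccontr)
  let ?s = "out_slope G \<phi>" and ?d = "((e, F), 0, 1)" and ?d' = "((e, F'), 0, 1)"
  assume "\<not> ?thesis"
  then have "?s ?d \<noteq> 0" "?s ?d' \<noteq> 0"
    using ln_min_if_slope_zero[OF F e] ln_min_if_slope_zero[OF F'(1,2) e] by auto
  then have "2 \<le> (\<Sum>d\<in>{?d, ?d'}. ?s d)"
    using F'(3) slope_nonneg[OF direction_at_pt[OF F] e] slope_nonneg[OF direction_at_pt[OF F'(1,2)] e]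
    by simp
  also have "\<dots> \<le> (\<Sum>d\<in>directions G (pt e). ?s d)"
    using direction_at_pt F F' e slope_nonneg
    by (intro sum_mono2 finite_directions[OF wf_G]) auto
  finally have "pl_div G \<phi> (pt e) \<le> - 2" by (simp add: pl_div_def)
  moreover have "e \<in> E" using F lines_subset by blast
  then have "0 \<le> D (pt e) + pl_div G \<phi> (pt e)"
    using \<phi> pt_in_points by (simp add: RD_def)
  then have "- 1 \<le> pl_div G \<phi> (pt e)" by (simp add: cartwright_divisor_def split: if_splits)
  ultimately show False by simp
qed

text \<open>Used contrapositively: where \<open>pl_div\<close> is positive, the function is not
  minimal. This is how the Brill-Noether condition at \<open>2x\<close> enters.\<close>

lemma div_le_zero_if_pt_min: "\<phi> (pt e) = c \<Longrightarrow> pl_div G \<phi> (pt e) \<le> 0"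
  using sum_nonneg[of "directions G (pt e)" "out_slope G \<phi>"] slope_nonneg by (simp add: pl_div_def)

text \<open>Minimality at a line passes to all its points, and a minimal point lies on at most one
  non-minimal line. It turns out that \<open>x\<close> is the only non-minimal point; a point
  \<open>t\<close> of \<open>F\<close> then has its non-minimal line in \<open>line t x\<close>, so
  \<open>F\<close> must be minimal.\<close>

lemma ln_min_iff:
  assumes attained: "(\<exists>e\<in>E. \<phi> (pt e) = c) \<or> (\<exists>F\<in>lines. \<phi> (ln F) = c)"
    and x: "x \<in> E" "\<phi> (pt x) \<noteq> c" and F: "F \<in> lines"
  shows "\<phi> (ln F) = c \<longleftrightarrow> x \<notin> F"
proof
  show "x \<notin> F" if "\<phi> (ln F) = c"
    using pt_min_if_ln_min[OF F _ that] x(2) by blast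
next
  assume xF: "x \<notin> F"
  obtain s where s: "s \<in> E" "\<phi> (pt s) = c"
    using attained pt_min_if_ln_min line_has_two_points lines_subset by (metis subsetD)
  obtain F1 F2 where "F1 \<in> lines" "F2 \<in> lines" "s \<in> F1" "s \<in> F2" "F1 \<noteq> F2"
    using two_lines_through[OF s(1)] .
  then obtain L where L: "L \<in> lines" "\<phi> (ln L) = c"
    using ln_min_if_pt_min[of F1 s F2] s(2) by blast
  have unique: "y = x" if y: "y \<in> E" "\<phi> (pt y) \<noteq> c" for y
  proof (rule ccontr)
    assume "y \<noteq> x"
    \<comment> \<open>Both lines from the minimal point \<open>t\<close> to \<open>x\<close> and
      \<open>y\<close> contain a non-minimal point, so both are non-minimal and must
      coincide.\<close>
    have on: "t \<in> line x y" if t: "t \<in> E" "\<phi> (pt t) = c" for t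
    proof -
      have ne: "t \<noteq> x" "t \<noteq> y" using t x y by auto
      let ?X = "line t x" and ?Y = "line t y"
      have lines: "?X \<in> lines" "?Y \<in> lines" using line_in_lines t x y ne by auto
      have mem: "t \<in> ?X" "x \<in> ?X" "t \<in> ?Y" "y \<in> ?Y" by (auto simp: line_def)
      have "\<phi> (ln ?X) \<noteq> c" "\<phi> (ln ?Y) \<noteq> c"
        using pt_min_if_ln_min lines mem x(2) y(2) by blast+
      then have "?X = ?Y" using ln_min_if_pt_min[OF lines(1) mem(1) lines(2) mem(3) _ t(2)] by blast
      then show ?thesis using line_unique[of ?X x y] lines mem \<open>y \<noteq> x\<close> by blast
    qed
    \<comment> \<open>All points of the minimal line \<open>L\<close> are minimal, hence on the line
      through \<open>x\<close> and \<open>y\<close>; so \<open>L\<close> is that line and contains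
      the non-minimal \<open>x\<close>.\<close>
    have "L \<subseteq> line x y"
      using on pt_min_if_ln_min[OF L(1) _ L(2)] lines_subset[OF L(1)] by blast
    moreover obtain a b where "a \<in> L" "b \<in> L" "a \<noteq> b" using line_has_two_points[OF L(1)] .
    ultimately have "L = line x y"
      using line_unique[OF L(1), of a b] line_unique[OF line_in_lines[of x y], of a b] x y \<open>y \<noteq> x\<close>
      by blast
    then have "x \<in> L" by (simp add: line_def)
    then show False using pt_min_if_ln_min[OF L(1) _ L(2)] x(2) by blast
  qed
  obtain t where t: "t \<in> F" using line_has_two_points[OF F] .
  then have tE: "t \<in> E" "t \<noteq> x" using lines_subset[OF F] xF by auto
  then have tc: "\<phi> (pt t) = c" using unique by blast
  have X: "line t x \<in> lines" "t \<in> line t x" "x \<in> line t x"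
    using line_in_lines tE x by (auto simp: line_def)
  then have "\<phi> (ln (line t x)) \<noteq> c" using pt_min_if_ln_min x(2) by blast
  moreover have "F \<noteq> line t x" using X xF by blast
  ultimately show "\<phi> (ln F) = c" using ln_min_if_pt_min[OF F t X(1,2) _ tc] by blast
qed

end

lemma separating_function:
  assumes \<phi>: "\<phi> \<in> RD G D" and x: "x \<in> E" "1 \<le> pl_div G \<phi> (pt x)"
  obtains c where "\<And>F. F \<in> lines \<Longrightarrow> x \<in> F \<Longrightarrow> c < \<phi> (ln F)"
    "\<And>F. F \<in> lines \<Longrightarrow> x \<notin> F \<Longrightarrow> \<phi> (ln F) = c"
proof -
  define A where "A = (\<lambda>e. \<phi> (pt e)) ` E \<union> (\<lambda>F. \<phi> (ln F)) ` lines"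
  \<comment> \<open>The minimum over the finitely many vertices is the global one by
    \<open>c_edge\<close>.\<close>
  define c where "c = Min A"
  have fin: "finite A" "A \<noteq> {}" using finite_ground finite_lines x by (auto simp: A_def)
  have c_pt: "\<forall>e\<in>E. c \<le> \<phi> (pt e)" and c_ln: "\<forall>F\<in>lines. c \<le> \<phi> (ln F)"
    unfolding c_def using fin by (auto simp: A_def intro!: Min_le)
  have "c \<in> A" unfolding c_def using fin by (rule Min_in)
  then have attained: "(\<exists>e\<in>E. \<phi> (pt e) = c) \<or> (\<exists>F\<in>lines. \<phi> (ln F) = c)"
    by (auto simp: A_def)
  have "\<phi> (pt x) \<noteq> c"
    using div_le_zero_if_pt_min[OF \<phi> c_pt c_ln, of x] x(2) by linarith
  note iff = ln_min_iff[OF \<phi> c_pt c_ln attained x(1) this]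
  show ?thesis
  proof
    show "c < \<phi> (ln F)" if "F \<in> lines" "x \<in> F" for F
      using iff[OF that(1)] that c_ln by force
    show "\<phi> (ln F) = c" if "F \<in> lines" "x \<notin> F" for F
      using iff[OF that(1)] that by simp
  qed
qed

end

section \<open>From a realized series to a realization of the matroid\<close>

lemma vector_space_of_ring_hom:
  fixes \<iota> :: "'k :: field \<Rightarrow> 'f :: field"
  assumes "\<iota> \<in> ring_hom ring_of_type_algebra ring_of_type_algebra"
  shows "vector_space (\<lambda>c f. \<iota> c * f)"
proof -
  have "\<iota> (x + y) = \<iota> x + \<iota> y" "\<iota> (x * y) = \<iota> x * \<iota> y" "\<iota> 1 = 1" for x y
    using assms by (simp_all add: ring_hom_def ring_of_type_algebra_def)
  then show ?thesis by unfold_locales (simp_all add: algebra_simps)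
qed

theorem corollary7p2:
  fixes E :: "'a set" and indep :: "'a set \<Rightarrow> bool" and elen :: "'a \<times> 'a set \<Rightarrow> real"
  assumes "simple_matroid E indep" and "mrank indep E = 3"
    and "\<And>e F. F \<in> flats E indep 2 \<Longrightarrow> e \<in> F \<Longrightarrow> 0 < elen (e, F)"
    and "\<not> realizable_matroid E indep"
  shows "\<not> (\<exists>\<Sigma> \<subseteq> RD (levi_graph E indep elen) (cartwright_divisor E).
           tropical_linear_series (levi_graph E indep elen) (cartwright_divisor E) 2 \<Sigma> \<and>
           realizable_series TYPE('k :: alg_closed_field) TYPE('f :: field)
             (levi_graph E indep elen) (cartwright_divisor E) 2 \<Sigma>)"
proof
  interpret levi E indep elen
    using assms(1-3) by (auto simp: levi_def levi_axioms_def simple_rank3_matroid_def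
        simple_rank3_matroid_axioms_def simple_matroid_def)
  assume "\<exists>\<Sigma> \<subseteq> RD G D. tropical_linear_series G D 2 \<Sigma> \<and>
    realizable_series TYPE('k) TYPE('f) G D 2 \<Sigma>"
  then obtain \<Sigma> where \<Sigma>: "\<Sigma> \<subseteq> RD G D" "tropical_linear_series G D 2 \<Sigma>"
    "realizable_series TYPE('k) TYPE('f) G D 2 \<Sigma>" by blast
  from \<Sigma>(3) obtain val :: "'k \<Rightarrow> ereal" and \<iota> :: "'k \<Rightarrow> 'f" and \<XX> t \<Phi> G' \<nu> \<theta> V
    where val: "base_field val" and \<iota>: "function_field \<iota>" and skel: "is_skeleton val \<iota> \<XX> t \<Phi> G' \<nu>"
      and \<theta>: "mgraph_isometry G G' \<theta>" and V: "module.subspace (\<lambda>c f. \<iota> c * f) V"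
        "vector_space.dim (\<lambda>c f. \<iota> c * f) V = 2 + 1"
      and trop: "\<Sigma> = (\<lambda>f. \<lambda>p\<in>points G. real_of_ereal (\<nu> (\<theta> p) f)) ` (V - {0})"
    unfolding realizable_series_def by blast
  define \<mu> where "\<mu> = (\<lambda>F. \<nu> (\<theta> (ln F)))"
  \<comment> \<open>Every point of the skeleton, vertex or not, carries a valuation extending
    \<open>val\<close>, so \<open>\<theta>\<close> may send a line into the interior of an
    edge.\<close>
  have "\<theta> p \<in> points G'" if "p \<in> points G" for p
    using \<theta> that unfolding mgraph_isometry_def bij_betw_def by blast
  then have \<mu>: "field_valuation (\<mu> F)" "\<mu> F (\<iota> c) = val c" if "F \<in> lines" for F c
    using skel ln_in_points[OF that] by (auto simp: is_skeleton_def \<mu>_def)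
  have vs: "vector_space (\<lambda>c f. \<iota> c * f)"
    using \<iota> vector_space_of_ring_hom by (auto simp: function_field_def)
  interpret vs: vector_space "\<lambda>c f. \<iota> c * f" by (rule vs)
  have "\<exists>w. w \<in> V \<and> (\<forall>F\<in>lines. (x \<in> F \<longrightarrow> 0 < \<mu> F w) \<and> (x \<notin> F \<longrightarrow> \<mu> F w = 0))" if x: "x \<in> E" for x
  proof -
    \<comment> \<open>The divisor \<open>2x\<close>: since \<open>D\<close> has only one chip at
      \<open>x\<close>, removing two forces \<open>pl_div\<close> to be at least 1 there.\<close>
    define D' where "D' = (\<lambda>p. if p = pt x then 2 else 0 :: int)"
    have supp: "{p. D' p \<noteq> 0} = {pt x}" by (auto simp: D'_def)
    have D': "D' \<in> divisors (points G)"
      using pt_in_points[OF x] by (simp add: divisors_def supp)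
    have deg: "(\<forall>p. 0 \<le> D' p) \<and> degree_div D' = 2"
      by (simp add: degree_div_def supp) (simp add: D'_def)
    have bn: "bn_condition G D \<Sigma> 2"
      using \<Sigma>(2) by (simp add: tropical_linear_series_def has_bn_rank_def)
    obtain \<phi> where \<phi>: "\<phi> \<in> \<Sigma>" "\<forall>p\<in>points G. 0 \<le> D p - D' p + pl_div G \<phi> p"
      using mp[OF bspec[OF bn[unfolded bn_condition_def] D'] deg] by (elim bexE)
    have "1 \<le> pl_div G \<phi> (pt x)"
      using bspec[OF \<phi>(2) pt_in_points[OF x]] x by (simp add: D'_def cartwright_divisor_def)
    then obtain c where c: "\<And>F. F \<in> lines \<Longrightarrow> x \<in> F \<Longrightarrow> c < \<phi> (ln F)"
      "\<And>F. F \<in> lines \<Longrightarrow> x \<notin> F \<Longrightarrow> \<phi> (ln F) = c"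
      using separating_function[of \<phi> x] \<phi>(1) \<Sigma>(1) x by blast
    obtain f where f: "f \<in> V" "f \<noteq> 0" "\<phi> = (\<lambda>p\<in>points G. real_of_ereal (\<nu> (\<theta> p) f))"
      using \<phi>(1) trop by auto
    \<comment> \<open>As \<open>f\<close> is nonzero its valuations are finite, so
      \<open>real_of_ereal\<close> loses nothing.\<close>
    have \<mu>f: "\<mu> F f = ereal (\<phi> (ln F))" if "F \<in> lines" for F
      using valuation_finite[OF \<mu>(1)[OF that] f(2)] ln_in_points[OF that] f(3) by (auto simp: \<mu>_def)
    \<comment> \<open>Surjectivity of \<open>val\<close> provides a scalar that shifts the minimum
      \<open>c\<close> to 0.\<close>
    have "ereal (- c) \<in> range val" using val by (simp add: base_field_def)
    then obtain a where a: "val a = ereal (- c)" by auto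
    have "\<mu> F (\<iota> a * f) = ereal (\<phi> (ln F) - c)" if "F \<in> lines" for F
      using valuation_mult[OF \<mu>(1)[OF that]] \<mu>(2)[OF that] \<mu>f[OF that] a by simp
    moreover have "\<iota> a * f \<in> V" using vs.subspace_scale[OF V(1) f(1)] .
    ultimately show ?thesis using c by (intro exI[of _ "\<iota> a * f"]) auto
  qed
  then obtain w where w: "\<And>x. x \<in> E \<Longrightarrow> w x \<in> V"
    "\<And>x F. x \<in> E \<Longrightarrow> F \<in> lines \<Longrightarrow> x \<in> F \<Longrightarrow> 0 < \<mu> F (w x)"
    "\<And>x F. x \<in> E \<Longrightarrow> F \<in> lines \<Longrightarrow> x \<notin> F \<Longrightarrow> \<mu> F (w x) = 0"
    by metis
  interpret separating_functions E indep val \<iota> \<mu> V w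
  proof unfold_locales
    show "0 < \<mu> F (w e)" if "F \<in> lines" "e \<in> F" for F e
      using w(2)[of e F] lines_subset that by blast
  qed (use val V w \<mu> in \<open>simp_all add: base_field_def\<close>)
  show False using realizable assms(4) by blast
qed

end
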